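(* Fix an integer $p\geq 3$ and $(\beta,h)\in(0,\infty)^2$, and let $\bm X=(X_1,\ldots,X_N)$ be a sample from the $p$-spin Curie-Weiss model $\mathbb{P}_{\beta,h,p}$ (defined in the context), with $S_N=\sum_{i=1}^N X_i$. Then: \begin{enumerate} \item If $(\beta,h)$ is $p$-regular, with $m_*$ the unique global maximizer of $H$, then $$\sup_{x\in\mathbb{R}}\left|\mathbb{P}\left(\frac{S_N-Nm_*}{\sqrt{-N/H''(m_* )}}\leq x\right)-\Phi(x)\right| = O\left(\frac{1}{\sqrt N}\right).$$ \item If $(\beta,h)$ is $p$-critical, then for every global maximizer $m$ of $H$ and every neighborhood $A$ of $m$ whose closure contains no other global maximizer of $H$, $$\sup_{x\in\mathbb{R}}\left|\mathbb{P}\left(\frac{S_N-Nm}{\sqrt{-N/H''(m)}}\leq x\,\Big|\,\frac{S_N}{N}\in A\right)-\Phi(x)\right| = O\left(\frac{1}{\sqrt N}\right).$$ \item If $(\beta,h)$ is $p$-special, with $m_*$ the unique global maximizer of $H$, then $$\sup_{x>0}\left|\mathbb{P}\left(\frac{S_N-Nm_*}{N^{3/4}}\leq x\right)-F(x)\right| = O\left(\frac{1}{N^{1/4}}\right),$$ where $F$ is the distribution function with Lebesgue density $\frac{2}{\Gamma(1/4)}\left(-\frac{H^{(4)}(m_* )}{24}\right)^{1/4}\exp\left(\frac{H^{(4)}(m_* )}{24}x^4\right)$, $x\in\mathbb{R}$. \end{enumerate}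
   Context: For $p\geq 2$, $\beta>0$, $h>0$, the $p$-spin Curie-Weiss model is the probability measure on $\{-1,1\}^N$ given by $$\mathbb{P}_{\beta,h,p}(\bm X) = \frac{\exp\left\{\beta N^{1-p}\sum_{1\leq i_1,\ldots,i_p\leq N} X_{i_1}\cdots X_{i_p} + h\sum_{i=1}^N X_i\right\}}{2^N Z_N(\beta,h,p)},$$ with $Z_N(\beta,h,p)$ the normalizing constant. Let $I(x)=\frac12\{(1+x)\log(1+x)+(1-x)\log(1-x)\}$ and $H(x)=H_{\beta,h,p}(x)=\beta x^p+hx-I(x)$ for $x\in[-1,1]$; $H^{(4)}$ is its fourth derivative. A global maximizer of $H$ is a point of $[-1,1]$ at which $H$ attains its maximum over $[-1,1]$. The point $(\beta,h)$ is $p$-regular if $H$ has a unique global maximizer $m_*\in(-1,1)$ with $H''(m_* )<0$; $p$-special if $H$ has a unique global maximizer $m_*\in(-1,1)$ with $H''(m_* )=0$; $p$-critical if $H$ has more than one global maximizer. $\Phi$ is the standard normal distribution function. *)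

theory Defs
  imports "HOL-Probability.Probability"
begin

text \<open>Entropy-type function I and the function H = H_{beta,h,p} on [-1,1].
  (Isabelle's ln 0 = 0, so the usual convention 0 log 0 = 0 holds at the endpoints.)\<close>
definition Ifun :: "real \<Rightarrow> real" where
  "Ifun x = ((1 + x) * ln (1 + x) + (1 - x) * ln (1 - x)) / 2"

definition Hfun :: "real \<Rightarrow> real \<Rightarrow> nat \<Rightarrow> real \<Rightarrow> real" where
  "Hfun \<beta> h p x = \<beta> * x ^ p + h * x - Ifun x"

definition Hder :: "nat \<Rightarrow> real \<Rightarrow> real \<Rightarrow> nat \<Rightarrow> real \<Rightarrow> real" where
  "Hder k \<beta> h p = (deriv ^^ k) (Hfun \<beta> h p)"

definition global_max :: "real \<Rightarrow> real \<Rightarrow> nat \<Rightarrow> real \<Rightarrow> bool" where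
  "global_max \<beta> h p m \<longleftrightarrow> m \<in> {-1..1} \<and> (\<forall>x\<in>{-1..1}. Hfun \<beta> h p x \<le> Hfun \<beta> h p m)"

definition p_regular :: "real \<Rightarrow> real \<Rightarrow> nat \<Rightarrow> bool" where
  "p_regular \<beta> h p \<longleftrightarrow> (\<exists>m. {x. global_max \<beta> h p x} = {m} \<and> -1 < m \<and> m < 1
       \<and> Hder 2 \<beta> h p m < 0)"

definition p_special :: "real \<Rightarrow> real \<Rightarrow> nat \<Rightarrow> bool" where
  "p_special \<beta> h p \<longleftrightarrow> (\<exists>m. {x. global_max \<beta> h p x} = {m} \<and> -1 < m \<and> m < 1
       \<and> Hder 2 \<beta> h p m = 0)"

definition p_critical :: "real \<Rightarrow> real \<Rightarrow> nat \<Rightarrow> bool" where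
  "p_critical \<beta> h p \<longleftrightarrow> (\<exists>m1 m2. m1 \<noteq> m2 \<and> global_max \<beta> h p m1 \<and> global_max \<beta> h p m2)"

definition configs :: "nat \<Rightarrow> (nat \<Rightarrow> real) set" where
  "configs N = {..<N} \<rightarrow>\<^sub>E {-1, 1}"

definition cw_weight :: "nat \<Rightarrow> real \<Rightarrow> real \<Rightarrow> nat \<Rightarrow> (nat \<Rightarrow> real) \<Rightarrow> real" where
  "cw_weight N \<beta> h p X = exp (\<beta> * real N powr (1 - real p)
      * (\<Sum>\<iota>\<in>{..<p} \<rightarrow>\<^sub>E {..<N}. \<Prod>k<p. X (\<iota> k)) + h * (\<Sum>i<N. X i))"

definition cw_Z :: "nat \<Rightarrow> real \<Rightarrow> real \<Rightarrow> nat \<Rightarrow> real" where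
  "cw_Z N \<beta> h p = (\<Sum>X\<in>configs N. cw_weight N \<beta> h p X) / 2 ^ N"

definition cw_prob :: "nat \<Rightarrow> real \<Rightarrow> real \<Rightarrow> nat \<Rightarrow> ((nat \<Rightarrow> real) \<Rightarrow> bool) \<Rightarrow> real" where
  "cw_prob N \<beta> h p E =
     (\<Sum>X\<in>{X\<in>configs N. E X}. cw_weight N \<beta> h p X) / (2 ^ N * cw_Z N \<beta> h p)"

definition cw_cond_prob :: "nat \<Rightarrow> real \<Rightarrow> real \<Rightarrow> nat \<Rightarrow> ((nat \<Rightarrow> real) \<Rightarrow> bool)
    \<Rightarrow> ((nat \<Rightarrow> real) \<Rightarrow> bool) \<Rightarrow> real" where
  "cw_cond_prob N \<beta> h p E C = cw_prob N \<beta> h p (\<lambda>X. E X \<and> C X) / cw_prob N \<beta> h p C"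

definition S_N :: "nat \<Rightarrow> (nat \<Rightarrow> real) \<Rightarrow> real" where
  "S_N N X = (\<Sum>i<N. X i)"

definition Phi :: "real \<Rightarrow> real" where
  "Phi x = measure (density lborel (\<lambda>t. ennreal (std_normal_density t))) {..x}"

text \<open>Distribution function F with density
  2/Gamma(1/4) (-H4/24)^{1/4} exp(H4/24 t^4), where H4 = H^{(4)}(m_*).\<close>
definition F_special :: "real \<Rightarrow> real \<Rightarrow> real" where
  "F_special H4 x = measure (density lborel
      (\<lambda>t. ennreal (2 / Gamma (1/4) * (- H4 / 24) powr (1/4) * exp (H4 / 24 * t ^ 4)))) {..x}"

definition is_nbhd :: "real set \<Rightarrow> real \<Rightarrow> bool" where
  "is_nbhd A m \<longleftrightarrow> (\<exists>U. open U \<and> m \<in> U \<and> U \<subseteq> A)"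

end

theory Submission
  imports Defs "HOL-Real_Asymp.Real_Asymp"
begin

text \<open>
  Under the Curie-Weiss measure the magnetization \<open>x = S_N / N\<close> has weight proportional to
  \<open>(N choose j) * exp (N (\<beta> x^p + h x))\<close> with \<open>x = 2 j / N - 1\<close>. By Stirling this is
  \<open>exp (N H x)\<close> up to a factor \<open>const * (1 + O(\<bar>x - m\<bar> + 1/N)) / sqrt N\<close> near a maximizer
  \<open>m\<close>, and a Chernoff bound makes everything away from the maximizers exponentially small.
  If \<open>H x = H m - a (x - m)^q + O(\<bar>x - m\<bar>^(q+1))\<close> with \<open>q\<close> even (\<open>q = 2\<close>, or \<open>q = 4\<close> in the
  special case), then in the variable \<open>t = N^(1/q) (x - m)\<close> the normalized weights differ from
  \<open>exp (- a t^q)\<close> by \<open>O(N^(-1/q) / (1 + t^2))\<close>. Such an error, as well as the error of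
  replacing a lattice sum by an integral, is summed by comparison with increments of the arctangent.
  The second derivative of \<open>H\<close> cannot have three zeros in the open unit interval, and Rolle's theorem
  would produce three of them from a degenerate maximizer that is not unique; hence maximizers
  at critical points are nondegenerate.
\<close>

section \<open>Distribution functions from lattice weights\<close>

text \<open>The envelope \<open>1 / (1 + t^2)\<close> is integrable over the whole line, so errors
  are summed over all lattice points at once: no growing window has to be cut out, and since the
  bounds hold for every partial sum they are uniform in the threshold. With
  \<open>T = N powr (1 / q)\<close> the lattice spacing in the variable \<open>t\<close> is
  \<open>2 * T / N\<close>, at most \<open>2 / T\<close> because \<open>q\<close> is at least 2, and
  the Taylor remainder \<open>N * \<bar>x - m\<bar>^(q+1)\<close> becomes
  \<open>\<bar>t\<bar>^(q+1) / T\<close>. This is why \<open>1 / T\<close> is the rate: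
  \<open>N^(-1/2)\<close> for nondegenerate maximizers and \<open>N^(-1/4)\<close> in the special
  case. Conditioning on a neighborhood is built into the weights, which are set to zero outside it;
  the unconditioned statements are the case of the whole line. In the special case maximality alone
  gives only a nonpositive fourth derivative. Strictness comes from the vanishing of the second and
  third derivatives, which ties \<open>\<beta>\<close> and \<open>p\<close> to \<open>m\<close> and
  leaves an explicit negative value.\<close>

lemma one_plus_sq_shift:
  fixes s t :: real
  assumes "\<bar>s - t\<bar> \<le> 2"
  shows "1 + s\<^sup>2 \<le> 10 * (1 + t\<^sup>2)"
proof -
  have "s\<^sup>2 \<le> 2 * t\<^sup>2 + 2 * (s - t)\<^sup>2"
    using zero_le_power2[of "s - 2 * t"] by (simp add: power2_eq_square algebra_simps)
  moreover have "(s - t)\<^sup>2 \<le> 4"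
    using assms abs_le_square_iff[of "s - t" 2] by simp
  ultimately have "s\<^sup>2 \<le> 2 * t\<^sup>2 + 8" by linarith
  then show ?thesis
    using zero_le_power2[of t] unfolding distrib_left by linarith
qed

text \<open>The envelope is the derivative of \<open>arctan\<close> up to the choice of a point in
  the cell; on cells of width at most 2 moving that point costs the factor 10. Sums of such terms
  telescope to at most a multiple of \<open>pi\<close>, however many cells there are.\<close>

lemma arctan_increment:
  fixes t d :: real
  assumes "0 \<le> d" "d \<le> 2"
  shows "d / (1 + t\<^sup>2) \<le> 10 * (arctan (t + d) - arctan t)"
proof (cases "d = 0")
  case False
  then have "t < t + d" using assms by simp
  then obtain z where z: "t < z" "z < t + d"
    "arctan (t + d) - arctan t = (t + d - t) * inverse (1 + z\<^sup>2)"
    using MVT2[of t "t + d" arctan "\<lambda>z. inverse (1 + z\<^sup>2)"] DERIV_arctan by blast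
  have "1 + z\<^sup>2 \<le> 10 * (1 + t\<^sup>2)"
    using z assms by (intro one_plus_sq_shift) auto
  moreover have "1 + z\<^sup>2 > 0" "1 + t\<^sup>2 > 0"
    by (simp_all add: add_pos_nonneg)
  ultimately have "1 / (1 + t\<^sup>2) \<le> 10 / (1 + z\<^sup>2)"
    by (simp add: field_simps)
  then have "d * (1 / (1 + t\<^sup>2)) \<le> d * (10 / (1 + z\<^sup>2))"
    using assms by (intro mult_left_mono)
  then show ?thesis using z by (simp add: field_simps)
qed simp

text \<open>\<open>K * arctan s - F s\<close> is nondecreasing, as its derivative is nonnegative.
  Comparing its values at \<open>- T\<close> and \<open>T\<close> with its limits at infinity leaves
  \<open>K * (pi / 2 - arctan T)\<close>, and \<open>pi / 2 - arctan T = arctan (1 / T)\<close> is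
  at most \<open>1 / T\<close>.\<close>

lemma cdf_tails:
  fixes F f :: "real \<Rightarrow> real"
  assumes deriv: "\<And>s. (F has_real_derivative f s) (at s)"
    and ub: "\<And>s. f s \<le> K / (1 + s\<^sup>2)"
    and bot: "(F \<longlongrightarrow> 0) at_bot" and top: "(F \<longlongrightarrow> 1) at_top"
    and "T > 0" "K \<ge> 0"
  shows "F (- T) \<le> K / T" and "1 - F T \<le> K / T"
proof -
  define D where "D = (\<lambda>s. K * arctan s - F s)"
  have "(D has_real_derivative (K * inverse (1 + s\<^sup>2) - f s)) (at s)" for s
    unfolding D_def by (auto intro!: derivative_eq_intros deriv)
  moreover have "K * inverse (1 + s\<^sup>2) - f s \<ge> 0" for s
    using ub[of s] by (simp add: divide_inverse)
  ultimately have mono: "D s \<le> D t" if "s \<le> t" for s t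
    using that DERIV_nonneg_imp_nondecreasing[of s t D] by blast
  have lim_bot: "(D \<longlongrightarrow> K * (- (pi / 2)) - 0) at_bot"
    unfolding D_def by (intro tendsto_intros bot tendsto_arctan_at_bot)
  have lim_top: "(D \<longlongrightarrow> K * (pi / 2) - 1) at_top"
    unfolding D_def by (intro tendsto_intros top tendsto_arctan_at_top)
  have "K * (- (pi / 2)) - 0 \<le> D (- T)"
    by (rule tendsto_upperbound[OF lim_bot])
      (auto intro!: eventually_mono[OF eventually_le_at_bot[of "- T"]] mono)
  moreover have "D T \<le> K * (pi / 2) - 1"
    by (rule tendsto_lowerbound[OF lim_top])
      (auto intro!: eventually_mono[OF eventually_ge_at_top[of T]] mono)
  moreover have "pi / 2 - arctan T \<le> 1 / T"
    using arctan_inverse[of "1 / T"] arctan_le_self[of "1 / T"] \<open>T > 0\<close> by simp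
  then have "K * (pi / 2 - arctan T) \<le> K * (1 / T)"
    using \<open>K \<ge> 0\<close> by (rule mult_left_mono)
  then have "K * (pi / 2) - K * arctan T \<le> K / T"
    by (simp add: algebra_simps)
  ultimately show "F (- T) \<le> K / T" "1 - F T \<le> K / T"
    unfolding D_def arctan_minus by linarith+
qed

text \<open>The error of the left-endpoint rule on one cell. Two mean value steps bound it by
  \<open>d * d\<close> times a value of \<open>\<bar>f'\<bar>\<close> inside the cell, and the
  envelope at that point is moved back to \<open>t\<close> at the cost of the factor 10.\<close>

lemma lattice_increment:
  fixes F f f' :: "real \<Rightarrow> real"
  assumes deriv: "\<And>s. (F has_real_derivative f s) (at s)"
    and deriv2: "\<And>s. (f has_real_derivative f' s) (at s)"
    and ub: "\<And>s. \<bar>f' s\<bar> \<le> K / (1 + s\<^sup>2)"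
    and d: "0 < d" "d \<le> 2"
  shows "\<bar>d * f t - (F (t + d) - F t)\<bar> \<le> 10 * K * d * d / (1 + t\<^sup>2)"
proof -
  obtain z where z: "t < z" "z < t + d" "F (t + d) - F t = (t + d - t) * f z"
    using MVT2[of t "t + d" F f] deriv d by auto
  obtain y where y: "t < y" "y < z" "f z - f t = (z - t) * f' y"
    using MVT2[of t z f f'] deriv2 z by auto
  have K: "K \<ge> 0" using ub[of 0] by simp
  have "1 + t\<^sup>2 \<le> 10 * (1 + y\<^sup>2)"
    using y z d by (intro one_plus_sq_shift) auto
  then have "1 / (1 + y\<^sup>2) \<le> 10 / (1 + t\<^sup>2)"
    by (simp add: field_simps add_pos_nonneg)
  then have "K * (1 / (1 + y\<^sup>2)) \<le> K * (10 / (1 + t\<^sup>2))"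
    using K by (rule mult_left_mono)
  with ub[of y] have f': "\<bar>f' y\<bar> \<le> 10 * K / (1 + t\<^sup>2)" by (simp add: mult.commute)
  have "\<bar>f z - f t\<bar> \<le> d * (10 * K / (1 + t\<^sup>2))"
    unfolding y(3) abs_mult using f' y z by (intro mult_mono) auto
  then have "d * \<bar>f z - f t\<bar> \<le> d * (d * (10 * K / (1 + t\<^sup>2)))"
    using d by (intro mult_left_mono) auto
  moreover have "d * f t - (F (t + d) - F t) = - (d * (f z - f t))"
    using z by (simp add: algebra_simps)
  then have "\<bar>d * f t - (F (t + d) - F t)\<bar> = d * \<bar>f z - f t\<bar>"
    using d by (simp add: abs_mult)
  ultimately show ?thesis by (simp add: mult_ac)
qed

text \<open>Each cell carries two errors, weight against density and Riemann sum against integral.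
  Both are of order \<open>\<epsilon> * d / (1 + t^2)\<close>: in the second, one of the two factors
  \<open>d\<close> is traded for \<open>2 * \<epsilon>\<close>. The remaining factor
  \<open>d\<close> is the cell width that the comparison with \<open>arctan\<close> consumes, so
  \<open>n\<close> does not enter the bound.\<close>

lemma lattice_partial_sums:
  fixes F f f' :: "real \<Rightarrow> real" and t0 d \<epsilon> K :: real and w :: "nat \<Rightarrow> real"
  defines "t \<equiv> \<lambda>j. t0 + real j * d"
  assumes deriv: "\<And>s. (F has_real_derivative f s) (at s)"
    and deriv2: "\<And>s. (f has_real_derivative f' s) (at s)"
    and ub: "\<And>s. \<bar>f' s\<bar> \<le> K / (1 + s\<^sup>2)"
    and d: "0 < d" "d \<le> 2 * \<epsilon>" "\<epsilon> \<le> 1"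
    and w: "\<And>j. j < n \<Longrightarrow> \<bar>w j - f (t j)\<bar> \<le> B * \<epsilon> / (1 + (t j)\<^sup>2)"
  shows "\<bar>d * (\<Sum>j<n. w j) - (F (t n) - F t0)\<bar> \<le> 10 * pi * (\<bar>B\<bar> + 20 * K) * \<epsilon>"
proof -
  have K: "K \<ge> 0" using ub[of 0] by simp
  have C: "(\<bar>B\<bar> + 20 * K) * \<epsilon> \<ge> 0" using K d by simp
  have step: "\<bar>d * w j - (F (t (Suc j)) - F (t j))\<bar>
      \<le> (\<bar>B\<bar> + 20 * K) * \<epsilon> * (10 * (arctan (t (Suc j)) - arctan (t j)))" if "j < n" for j
  proof -
    have Suc: "t (Suc j) = t j + d" by (simp add: t_def algebra_simps)
    have p: "1 + (t j)\<^sup>2 > 0" by (simp add: add_pos_nonneg)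
    have "B * \<epsilon> / (1 + (t j)\<^sup>2) \<le> \<bar>B\<bar> * \<epsilon> / (1 + (t j)\<^sup>2)"
      using d p by (intro divide_right_mono mult_right_mono) auto
    with w[OF that] have "\<bar>w j - f (t j)\<bar> \<le> \<bar>B\<bar> * \<epsilon> / (1 + (t j)\<^sup>2)"
      by (rule order_trans)
    then have "d * \<bar>w j - f (t j)\<bar> \<le> d * (\<bar>B\<bar> * \<epsilon> / (1 + (t j)\<^sup>2))"
      using d by (intro mult_left_mono) auto
    then have 1: "\<bar>d * w j - d * f (t j)\<bar> \<le> \<bar>B\<bar> * \<epsilon> * (d / (1 + (t j)\<^sup>2))"
      using d by (simp add: abs_mult mult_ac flip: right_diff_distrib)
    have "10 * K * d * d / (1 + (t j)\<^sup>2) \<le> 10 * K * (2 * \<epsilon>) * d / (1 + (t j)\<^sup>2)"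
      using d K p by (intro divide_right_mono mult_right_mono mult_left_mono) auto
    with lattice_increment[OF deriv deriv2 ub, where d = d and t = "t j"] d
    have 2: "\<bar>d * f (t j) - (F (t (Suc j)) - F (t j))\<bar> \<le> 20 * K * \<epsilon> * (d / (1 + (t j)\<^sup>2))"
      unfolding Suc by (simp add: mult_ac)
    have "\<bar>d * w j - (F (t (Suc j)) - F (t j))\<bar> \<le> (\<bar>B\<bar> + 20 * K) * \<epsilon> * (d / (1 + (t j)\<^sup>2))"
      using 1 2 by (simp add: algebra_simps)
    also have "\<dots> \<le> (\<bar>B\<bar> + 20 * K) * \<epsilon> * (10 * (arctan (t (Suc j)) - arctan (t j)))"
      unfolding Suc using d C by (intro mult_left_mono arctan_increment) auto
    finally show ?thesis .
  qed
  have "F (t n) - F t0 = (\<Sum>j<n. F (t (Suc j)) - F (t j))"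
    unfolding sum_lessThan_telescope[of "\<lambda>j. F (t j)"] by (simp add: t_def)
  then have "d * (\<Sum>j<n. w j) - (F (t n) - F t0)
      = (\<Sum>j<n. d * w j - (F (t (Suc j)) - F (t j)))"
    by (simp only: sum_subtractf sum_distrib_left)
  also have "\<bar>\<dots>\<bar> \<le> (\<Sum>j<n. (\<bar>B\<bar> + 20 * K) * \<epsilon> * (10 * (arctan (t (Suc j)) - arctan (t j))))"
    by (rule order_trans[OF sum_abs sum_mono]) (use step in auto)
  also have "\<dots> = (\<bar>B\<bar> + 20 * K) * \<epsilon> * (10 * (arctan (t n) - arctan (t 0)))"
    by (simp only: sum_lessThan_telescope[of "\<lambda>j. arctan (t j)"] flip: sum_distrib_left)
  also have "\<dots> \<le> (\<bar>B\<bar> + 20 * K) * \<epsilon> * (10 * pi)"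
    using C arctan_bounded[of "t n"] arctan_bounded[of "t 0"] by (intro mult_left_mono) auto
  finally show ?thesis by (simp add: mult_ac)
qed

text \<open>\<open>A / Z - F = ((A - F) - F * (Z - 1)) / Z\<close>, where the numerator is at most
  \<open>2 * \<epsilon>\<close> and the denominator at least \<open>1 / 2\<close>.\<close>

lemma ratio_bound:
  fixes A Z F \<epsilon> :: real
  assumes "\<bar>A - F\<bar> \<le> \<epsilon>" "\<bar>Z - 1\<bar> \<le> \<epsilon>" "\<epsilon> \<le> 1 / 2" "0 \<le> F" "F \<le> 1"
  shows "\<bar>A / Z - F\<bar> \<le> 4 * \<epsilon>"
proof -
  have Z: "Z \<ge> 1 / 2" using assms by linarith
  have "F * \<bar>Z - 1\<bar> \<le> 1 * \<epsilon>" using assms by (intro mult_mono) auto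
  then have "\<bar>F * (Z - 1)\<bar> \<le> \<epsilon>" using assms by (simp add: abs_mult)
  moreover have "A - F * Z = (A - F) - F * (Z - 1)" by (simp add: algebra_simps)
  ultimately have "\<bar>A - F * Z\<bar> \<le> 2 * \<epsilon>"
    using assms(1) by linarith
  also have "2 * \<epsilon> \<le> 4 * \<epsilon> * Z"
    using Z assms mult_left_mono[of "1/2" Z "4 * \<epsilon>"] by (simp add: abs_le_iff)
  finally have "\<bar>A - F * Z\<bar> / Z \<le> 4 * \<epsilon>" using Z by (simp add: field_simps)
  moreover have "A / Z - F = (A - F * Z) / Z" using Z by (simp add: field_simps)
  ultimately show ?thesis using Z by simp
qed

text \<open>The weights may be unnormalised: the lattice reaches from
  \<open>- c / \<epsilon>\<close> to \<open>c / \<epsilon>\<close>, so it misses only mass of order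
  \<open>\<epsilon>\<close>, and \<open>d\<close> times the full sum is within that order of 1. The
  constants precede the lattice, the weights and \<open>y\<close> in the quantifier order; this is
  the uniformity required for a supremum over thresholds.\<close>

lemma lattice_cdf_approx:
  fixes F f f' :: "real \<Rightarrow> real" and K B c :: real
  assumes deriv: "\<And>s. (F has_real_derivative f s) (at s)"
    and deriv2: "\<And>s. (f has_real_derivative f' s) (at s)"
    and nn: "\<And>s. 0 \<le> f s"
    and ub1: "\<And>s. f s \<le> K / (1 + s\<^sup>2)"
    and ub: "\<And>s. \<bar>f' s\<bar> \<le> K / (1 + s\<^sup>2)"
    and bot: "(F \<longlongrightarrow> 0) at_bot" and top: "(F \<longlongrightarrow> 1) at_top"
    and c: "c > 0"
  shows "\<exists>\<epsilon>0>0. \<exists>C. \<forall>t0 d \<epsilon> w N y.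
    0 < d \<longrightarrow> d \<le> 2 * \<epsilon> \<longrightarrow> \<epsilon> \<le> \<epsilon>0 \<longrightarrow> t0 \<le> - c / \<epsilon> \<longrightarrow> t0 + real N * d \<ge> c / \<epsilon> \<longrightarrow>
    (\<forall>j\<le>N. \<bar>w j - f (t0 + real j * d)\<bar> \<le> B * \<epsilon> / (1 + (t0 + real j * d)\<^sup>2)) \<longrightarrow>
     \<bar>(\<Sum>j | j \<le> N \<and> t0 + real j * d \<le> y. w j) / (\<Sum>j\<le>N. w j) - F y\<bar> \<le> C * \<epsilon>"
proof -
  have K: "K \<ge> 0" using ub[of 0] by simp
  have mono: "F s \<le> F t" if "s \<le> t" for s t
    using that DERIV_nonneg_imp_nondecreasing[of s t F] deriv nn by blast
  have F0: "F s \<ge> 0" for s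
    by (rule tendsto_upperbound[OF bot])
      (auto intro!: eventually_mono[OF eventually_le_at_bot[of s]] mono)
  have F1: "F s \<le> 1" for s
    by (rule tendsto_lowerbound[OF top])
      (auto intro!: eventually_mono[OF eventually_ge_at_top[of s]] mono)
  define E where "E = 10 * pi * (\<bar>B\<bar> + 20 * K)"
  \<comment> \<open>The budget: \<open>E\<close> for the lattice sum, twice \<open>K / c\<close> for
    the tails beyond the two ends of the lattice, and \<open>2 * K\<close> for rounding
    \<open>y\<close> to a lattice point. The bound on \<open>\<epsilon>\<close> chosen below makes
    \<open>D * \<epsilon>\<close> at most \<open>1 / 2\<close>, as the division by the total
    requires.\<close>
  define D where "D = E + 2 * (K / c) + 2 * K"
  have D: "D \<ge> 0" using K c by (simp add: D_def E_def)
  show ?thesis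
  proof (rule exI[of _ "min 1 (1 / (2 * (D + 1)))"], intro conjI exI[of _ "4 * D"] allI impI)
    show "min 1 (1 / (2 * (D + 1))) > 0" using D by simp
  next
    fix t0 d \<epsilon> y :: real and w :: "nat \<Rightarrow> real" and N :: nat
    assume d: "0 < d" "d \<le> 2 * \<epsilon>" and \<epsilon>: "\<epsilon> \<le> min 1 (1 / (2 * (D + 1)))"
      and t0: "t0 \<le> - c / \<epsilon>" and tN: "t0 + real N * d \<ge> c / \<epsilon>"
      and "\<forall>j\<le>N. \<bar>w j - f (t0 + real j * d)\<bar> \<le> B * \<epsilon> / (1 + (t0 + real j * d)\<^sup>2)"
    then have w: "\<And>j. j \<le> N \<Longrightarrow>
        \<bar>w j - f (t0 + real j * d)\<bar> \<le> B * \<epsilon> / (1 + (t0 + real j * d)\<^sup>2)" by blast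
    have \<epsilon>0: "\<epsilon> > 0" using d by simp
    have D\<epsilon>: "D * \<epsilon> \<le> 1 / 2"
    proof -
      have "D * \<epsilon> \<le> (D + 1) * (1 / (2 * (D + 1)))"
        using D \<epsilon> \<epsilon>0 by (intro mult_mono) auto
      also have "\<dots> = 1 / 2" using D by (simp add: field_simps)
      finally show ?thesis .
    qed
    define t where "t = (\<lambda>j. t0 + real j * d)"
    have left: "F t0 \<le> K / c * \<epsilon>"
      using cdf_tails(1)[OF deriv ub1 bot top, of "c / \<epsilon>"] mono[OF t0] c \<epsilon>0 K by simp
    have right: "1 - F s \<le> K / c * \<epsilon>" if "s \<ge> t N" for s
    proof -
      have "F (c / \<epsilon>) \<le> F s"
        using that tN by (intro mono) (simp add: t_def)
      then show ?thesis
        using cdf_tails(2)[OF deriv ub1 bot top, of "c / \<epsilon>"] c \<epsilon>0 K by simp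
    qed
    \<comment> \<open>\<open>A n\<close> covers the cells with left endpoints \<open>t 0\<close> to
      \<open>t (n - 1)\<close> and is therefore compared with \<open>F (t n)\<close>. The sum over
      all \<open>j \<le> N\<close> is \<open>A (Suc N)\<close>, whose last cell ends one step beyond
      the lattice.\<close>
    define A where "A = (\<lambda>n. d * (\<Sum>j<n. w j))"
    have D_eq: "D * \<epsilon> = E * \<epsilon> + 2 * (K / c * \<epsilon>) + 2 * K * \<epsilon>"
      by (simp add: D_def distrib_right)
    have A: "\<bar>A n - F (t n)\<bar> \<le> E * \<epsilon> + K / c * \<epsilon>" if "n \<le> Suc N" for n
    proof -
      have "\<bar>A n - (F (t n) - F t0)\<bar> \<le> E * \<epsilon>"
        unfolding E_def A_def t_def using d \<epsilon> w that
        by (intro lattice_partial_sums[OF deriv deriv2 ub]) auto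
      then show ?thesis using left F0[of t0] by linarith
    qed
    have Z: "\<bar>A (Suc N) - 1\<bar> \<le> D * \<epsilon>"
    proof -
      have "t (Suc N) \<ge> t N" using d by (simp add: t_def)
      then have "1 - F (t (Suc N)) \<le> K / c * \<epsilon>" by (rule right)
      moreover have "2 * K * \<epsilon> \<ge> 0" using K \<epsilon>0 by simp
      ultimately show ?thesis
        using A[of "Suc N"] F1[of "t (Suc N)"] D_eq by linarith
    qed
    have key: "\<bar>A n - F y\<bar> \<le> D * \<epsilon>"
      if n: "n \<le> Suc N" "\<bar>F (t n) - F y\<bar> \<le> K / c * \<epsilon> + 2 * K * \<epsilon>" for n
      using A[OF n(1)] n(2) D_eq by linarith
    have tmono: "t i \<le> t j \<longleftrightarrow> i \<le> j" for i j
      using d by (simp add: t_def)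
    have "\<exists>n \<le> Suc N. {j. j \<le> N \<and> t j \<le> y} = {..<n} \<and> \<bar>F (t n) - F y\<bar> \<le> K / c * \<epsilon> + 2 * K * \<epsilon>"
    proof -
      have K1: "K / c * \<epsilon> \<ge> 0" and K2: "2 * K * \<epsilon> \<ge> 0" using K c \<epsilon>0 by auto
      consider "y < t0" | "y \<ge> t N" | "t0 \<le> y" "y < t N" by linarith
      then show ?thesis
      proof cases
        case 1
        then have "t j \<le> y \<longleftrightarrow> False" for j
          using tmono[of 0 j] by (auto simp: t_def)
        moreover have "F y \<le> F t0" using 1 by (intro mono) simp
        ultimately show ?thesis using left F0[of y] F0[of t0] K1 K2
          by (intro exI[of _ 0]) (auto simp: t_def)
      next
        case 2
        then have "t j \<le> y" if "j \<le> N" for j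
          using tmono[of j N] that by simp
        then have "{j. j \<le> N \<and> t j \<le> y} = {..<Suc N}" by auto
        moreover have "1 - F (t (Suc N)) \<le> K / c * \<epsilon>"
          using tmono by (intro right) simp
        moreover have "1 - F y \<le> K / c * \<epsilon>" using 2 by (rule right)
        ultimately show ?thesis using F1[of y] F1[of "t (Suc N)"] K1 K2
          by (intro exI[of _ "Suc N"]) auto
      next
        case 3
        \<comment> \<open>The first lattice point beyond \<open>y\<close>. Since
          \<open>t (n - 1) \<le> y < t n\<close>, exactly the first \<open>n\<close> points lie
          below the threshold, and \<open>F\<close> changes between \<open>y\<close> and
          \<open>t n\<close> by at most \<open>d * K\<close>.\<close>
        define n where "n = (LEAST n. y < t n)"
        have n: "y < t n" unfolding n_def using 3(2) by (rule LeastI)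
        have nN: "n \<le> N" unfolding n_def using 3(2) by (rule Least_le)
        have lt: "t j \<le> y" if "j < n" for j
          using not_less_Least[of j "\<lambda>n. y < t n"] that by (auto simp: n_def)
        have "n \<noteq> 0"
        proof
          assume "n = 0"
          then show False using n 3(1) by (simp add: t_def)
        qed
        then obtain k where k: "n = Suc k" by (cases n) auto
        have "j < n" if "t j \<le> y" for j
        proof (rule ccontr)
          assume "\<not> j < n"
          then have "t n \<le> t j" using tmono by simp
          then show False using that n by linarith
        qed
        then have "{j. j \<le> N \<and> t j \<le> y} = {..<n}"
          using lt nN by auto
        moreover have "\<bar>F (t n) - F y\<bar> \<le> 2 * K * \<epsilon>"
        proof -
          obtain z where z: "F (t n) - F y = (t n - y) * f z"
            using MVT2[of y "t n" F f] n deriv by auto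
          have "t n - y \<le> d" using lt[of k] k by (simp add: t_def algebra_simps)
          moreover have "f z \<le> K"
          proof -
            have "K / (1 + z\<^sup>2) \<le> K / 1"
              using K by (intro divide_left_mono) (auto simp: add_pos_nonneg)
            then show ?thesis using ub1[of z] by simp
          qed
          ultimately have "(t n - y) * f z \<le> d * K"
            using n nn[of z] d by (intro mult_mono) auto
          moreover have "d * K \<le> 2 * \<epsilon> * K" using d K by (intro mult_right_mono)
          moreover have "(t n - y) * f z \<ge> 0" using n nn[of z] by simp
          ultimately show ?thesis using z by (simp add: mult_ac)
        qed
        ultimately show ?thesis using nN K1 by (intro exI[of _ n]) auto
      qed
    qed
    then obtain n where n: "n \<le> Suc N" "{j. j \<le> N \<and> t j \<le> y} = {..<n}"
      "\<bar>F (t n) - F y\<bar> \<le> K / c * \<epsilon> + 2 * K * \<epsilon>" by blast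
    have "\<bar>A n / A (Suc N) - F y\<bar> \<le> 4 * (D * \<epsilon>)"
      by (intro ratio_bound key n Z D\<epsilon> F0 F1)
    moreover have "A n / A (Suc N)
        = (\<Sum>j | j \<le> N \<and> t0 + real j * d \<le> y. w j) / (\<Sum>j\<le>N. w j)"
      using n(2) d unfolding A_def t_def by (simp add: lessThan_Suc_atMost)
    ultimately show "\<bar>(\<Sum>j | j \<le> N \<and> t0 + real j * d \<le> y. w j) / (\<Sum>j\<le>N. w j) - F y\<bar>
        \<le> 4 * D * \<epsilon>" by simp
  qed
qed

section \<open>The limit laws\<close>

lemma density_cdf:
  fixes g :: "real \<Rightarrow> real"
  assumes cont: "continuous_on UNIV g" and nn: "\<And>x. 0 \<le> g x"
    and prob: "(\<integral>\<^sup>+x. ennreal (g x) \<partial>lborel) = 1"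
  defines "G \<equiv> \<lambda>x. measure (density lborel (\<lambda>t. ennreal (g t))) {..x}"
  shows "(G has_real_derivative g x) (at x)"
    and "(G \<longlongrightarrow> 0) at_bot" and "(G \<longlongrightarrow> 1) at_top"
proof -
  let ?M = "density lborel (\<lambda>t. ennreal (g t))"
  have meas[measurable]: "g \<in> borel_measurable borel"
    using cont by (rule borel_measurable_continuous_onI)
  have "prob_space ?M"
    using prob by (intro prob_spaceI) (simp add: emeasure_density)
  then interpret M: real_distribution ?M
    by (intro real_distribution.intro real_distribution_axioms.intro) simp_all
  have G: "G = cdf ?M" unfolding G_def cdf_def ..
  show "(G \<longlongrightarrow> 0) at_bot" "(G \<longlongrightarrow> 1) at_top"
    unfolding G by (rule M.cdf_lim_at_bot, rule M.cdf_lim_at_top_prob)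
  have diff: "G b - G a = integral {a..b} g" if "a \<le> b" for a b
  proof (cases "a = b")
    case False
    then have "a < b" using that by simp
    have cab: "continuous_on {a..b} g" using cont continuous_on_subset by blast
    then have int: "set_integrable lborel {a..b} g"
      by (intro borel_integrable_atLeastAtMost') 
    have "ennreal (measure ?M {a<..b}) = (\<integral>\<^sup>+x. ennreal (g x) * indicator {a<..b} x \<partial>lborel)"
      by (simp add: M.emeasure_eq_measure[symmetric] emeasure_density)
    also have "\<dots> = (\<integral>\<^sup>+x. ennreal (g x) * indicator {a..b} x \<partial>lborel)"
      by (rule nn_integral_cong_AE, rule eventually_mono[OF AE_lborel_singleton[of a]])
         (simp add: indicator_def)
    also have "\<dots> = (\<integral>\<^sup>+x. ennreal (indicator {a..b} x *\<^sub>R g x) \<partial>lborel)"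
      by (intro nn_integral_cong) (auto simp: indicator_def)
    also have "\<dots> = ennreal (LINT x:{a..b}|lborel. g x)"
      unfolding set_lebesgue_integral_def using int nn
      by (intro nn_integral_eq_integral) (auto simp: set_integrable_def)
    also have "(LINT x:{a..b}|lborel. g x) = integral {a..b} g"
      using int by (rule set_borel_integral_eq_integral)
    finally have "measure ?M {a<..b} = integral {a..b} g"
      using nn cab by (subst (asm) ennreal_inj) (auto intro!: integral_nonneg integrable_continuous_real)
    then show ?thesis
      using M.cdf_diff_eq[OF \<open>a < b\<close>] by (simp add: G)
  qed simp
  \<comment> \<open>Any compact interval with \<open>x\<close> in its interior serves: there
    \<open>G\<close> differs by the constant \<open>G a\<close> from an integral with variable upper
    limit, and the fundamental theorem of calculus applies.\<close>
  define a b where "a = x - 1" and "b = x + 1"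
  have "((\<lambda>u. integral {a..u} g) has_real_derivative g x) (at x within {a..b})"
    using cont by (intro integral_has_real_derivative) (auto simp: a_def b_def intro: continuous_on_subset)
  then have "((\<lambda>u. integral {a..u} g) has_real_derivative g x) (at x)"
    by (simp add: a_def b_def at_within_Icc_at)
  then have "((\<lambda>u. G a + integral {a..u} g) has_real_derivative g x) (at x)"
    by (auto intro!: derivative_eq_intros)
  moreover have "\<forall>\<^sub>F u in nhds x. G u = G a + integral {a..u} g"
    using eventually_nhds_in_open[of "{a<..<b}" x]
    by (rule eventually_mono) (auto simp: a_def b_def diff[symmetric] less_imp_le)
  ultimately show "(G has_real_derivative g x) (at x)"
    using DERIV_cong_ev by metis
qed

text \<open>Substituting \<open>t = a * x ^ 4\<close> in Euler's integral turns
  \<open>t powr (1/4 - 1) dt\<close> into \<open>4 * a powr (1/4) dx\<close>. At the origin the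
  transformed integrand is 0 instead of \<open>4 * a powr (1/4)\<close>, so the computation runs on
  the open half line and the null point is added back at the end.\<close>

lemma nn_integral_quartic_halfline:
  fixes a :: real
  assumes "a > 0"
  shows "(\<integral>\<^sup>+x. ennreal (exp (- a * x ^ 4)) * indicator {0..} x \<partial>lborel)
    = ennreal (Gamma (1 / 4) / (4 * a powr (1 / 4)))"
proof -
  define f where "f = (\<lambda>t::real. t powr (1/4 - 1) / exp t)"
  define u where "u = (\<lambda>x::real. a * x ^ 4)"
  define u' where "u' = (\<lambda>x::real. 4 * a * x ^ 3)"
  have "(f has_integral Gamma (1/4)) {0..}"
    unfolding f_def by (rule Gamma_integral_real) simp
  then have "((\<lambda>t. if t \<in> {0<..} then f t else 0) has_integral Gamma (1/4)) {0..}"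
    by (rule has_integral_spike [of "{0}", rotated 2]) auto
  then have f: "(f has_integral Gamma (1/4)) {0<..}"
    by (subst (asm) has_integral_restrict) auto
  then have fabs: "f absolutely_integrable_on {0<..}"
    by (intro nonnegative_absolutely_integrable_1) (auto simp: f_def)
  have inj: "inj_on u {0<..}"
    using assms by (auto simp: inj_on_def u_def intro: power_eq_imp_eq_base)
  have img: "u ` {0<..} = {0<..}"
  proof (intro equalityI subsetI)
    fix y :: real assume "y \<in> {0<..}"
    then have "y = u (root 4 (y / a))" "root 4 (y / a) \<in> {0<..}"
      using assms by (auto simp: u_def real_root_pow_pos2)
    then show "y \<in> u ` {0<..}" by blast
  qed (use assms in \<open>auto simp: u_def\<close>)
  have der: "(u has_field_derivative u' x) (at x within {0<..})" for x
    unfolding u_def u'_def by (auto intro!: derivative_eq_intros)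
  have "f absolutely_integrable_on u ` {0<..} \<and> integral (u ` {0<..}) f = Gamma (1/4)"
    unfolding img using fabs integral_unique[OF f] by blast
  then have "(\<lambda>x. \<bar>u' x\<bar> * f (u x)) absolutely_integrable_on {0<..} \<and>
      integral {0<..} (\<lambda>x. \<bar>u' x\<bar> * f (u x)) = Gamma (1/4)"
    by (subst has_absolute_integral_change_of_variables_1'[OF _ der inj]) simp_all
  then have "((\<lambda>x. \<bar>u' x\<bar> * f (u x)) has_integral Gamma (1/4)) {0<..}"
    using integrable_integral set_lebesgue_integral_eq_integral(1) by metis
  moreover have "\<bar>u' x\<bar> * f (u x) = 4 * a powr (1/4) * exp (- a * x ^ 4)" if "x \<in> {0<..}" for x
  proof -
    have x: "x > 0" using that by simp
    have "(x ^ 4) powr (1/4) = x"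
      using x by (simp add: powr_powr flip: powr_numeral)
    then have "(a * x ^ 4) powr (1/4 - 1) = a powr (1/4) * x / (a * x ^ 4)"
      using assms x unfolding powr_diff by (simp add: powr_mult)
    moreover have "4 * a * x ^ 3 * (a powr (1/4) * x / (a * x ^ 4)) = 4 * a powr (1/4)"
      using assms x by (simp add: field_simps eval_nat_numeral)
    ultimately have "4 * a * x ^ 3 * (a * x ^ 4) powr (1/4 - 1) = 4 * a powr (1/4)"
      by simp
    moreover have "\<bar>u' x\<bar> = 4 * a * x ^ 3" using assms x by (simp add: u'_def)
    ultimately show ?thesis
      by (simp add: f_def u_def exp_minus field_simps)
  qed
  ultimately have "((\<lambda>x. 4 * a powr (1/4) * exp (- a * x ^ 4)) has_integral Gamma (1/4)) {0<..}"
    using has_integral_cong by (metis (no_types, lifting))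
  then have "((\<lambda>x. (4 * a powr (1/4) * exp (- a * x ^ 4)) / (4 * a powr (1/4)))
      has_integral Gamma (1/4) / (4 * a powr (1/4))) {0<..}"
    by (rule has_integral_divide)
  then have "((\<lambda>x. exp (- a * x ^ 4)) has_integral Gamma (1/4) / (4 * a powr (1/4))) {0<..}"
    using assms by simp
  then have "((\<lambda>x. if x \<in> {0<..} then exp (- a * x ^ 4) else 0) has_integral
      Gamma (1/4) / (4 * a powr (1/4))) {0..}"
    by (subst has_integral_restrict) auto
  then have "((\<lambda>x. exp (- a * x ^ 4)) has_integral Gamma (1/4) / (4 * a powr (1/4))) {0..}"
    by (rule has_integral_spike [of "{0}", rotated 2]) auto
  from nn_integral_has_integral_lebesgue[OF _ this] show ?thesis
    by (simp add: ennreal_mult' ennreal_indicator mult.commute)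
qed

lemma nn_integral_quartic:
  fixes a :: real
  assumes "a > 0"
  shows "(\<integral>\<^sup>+x. ennreal (2 / Gamma (1/4) * a powr (1/4) * exp (- a * x ^ 4)) \<partial>lborel) = 1"
proof -
  let ?f = "\<lambda>x::real. ennreal (exp (- a * x ^ 4))"
  let ?I = "Gamma (1 / 4) / (4 * a powr (1 / 4))"
  have G: "Gamma (1 / 4 :: real) > 0" by (rule Gamma_real_pos) simp
  have pos: "(\<integral>\<^sup>+x. ?f x * indicator {0..} x \<partial>lborel) = ennreal ?I"
    by (rule nn_integral_quartic_halfline) fact
  have "(\<integral>\<^sup>+x. ?f x * indicator {0..} x \<partial>lborel)
      = ennreal \<bar>-1\<bar> * (\<integral>\<^sup>+x. ?f (0 + -1 * x) * indicator {0..} (0 + -1 * x) \<partial>lborel)"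
    by (rule nn_integral_real_affine) auto
  also have "\<dots> = (\<integral>\<^sup>+x. ?f x * indicator {..0} x \<partial>lborel)"
    by (auto simp: indicator_def intro!: nn_integral_cong)
  finally have neg: "(\<integral>\<^sup>+x. ?f x * indicator {..0} x \<partial>lborel) = ennreal ?I"
    using pos by simp
  have "(\<integral>\<^sup>+x. ?f x \<partial>lborel)
      = (\<integral>\<^sup>+x. ?f x * indicator {0..} x + ?f x * indicator {..0} x \<partial>lborel)"
    by (rule nn_integral_cong_AE, rule eventually_mono[OF AE_lborel_singleton[of 0]])
       (simp add: indicator_def)
  also have "\<dots> = (\<integral>\<^sup>+x. ?f x * indicator {0..} x \<partial>lborel)
      + (\<integral>\<^sup>+x. ?f x * indicator {..0} x \<partial>lborel)"
    by (rule nn_integral_add) measurable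
  also have "\<dots> = ennreal ?I + ennreal ?I"
    unfolding pos neg ..
  also have "\<dots> = ennreal (2 * ?I)"
    using G by (simp flip: ennreal_plus)
  finally have *: "(\<integral>\<^sup>+x. ?f x \<partial>lborel) = ennreal (2 * ?I)" .
  have "(\<integral>\<^sup>+x. ennreal (2 / Gamma (1/4) * a powr (1/4) * exp (- a * x ^ 4)) \<partial>lborel)
      = (\<integral>\<^sup>+x. ennreal (2 / Gamma (1/4) * a powr (1/4)) * ?f x \<partial>lborel)"
    using G by (intro nn_integral_cong ennreal_mult) auto
  also have "\<dots> = ennreal (2 / Gamma (1/4) * a powr (1/4)) * ennreal (2 * ?I)"
    unfolding *[symmetric] by (rule nn_integral_cmult) measurable
  also have "\<dots> = ennreal (2 / Gamma (1/4) * a powr (1/4) * (2 * ?I))"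
    using G by (intro ennreal_mult[symmetric]) auto
  also have "2 / Gamma (1/4) * a powr (1/4) * (2 * ?I) = 1"
    using less_imp_neq[OF G] assms by (simp add: field_simps)
  finally show ?thesis by simp
qed

section \<open>Entropy asymptotics and the law of the magnetization\<close>

text \<open>The value of the constant is irrelevant below, since it cancels in the normalisation.\<close>
lemma stirling_up_to_constant:
  obtains c :: real where
    "\<And>n. n \<ge> 1 \<Longrightarrow> \<bar>ln (fact n) - ((real n + 1 / 2) * ln (real n) - real n) - c\<bar> \<le> 1 / (4 * real n)"
proof -
  \<comment> \<open>By convexity of \<open>1 / x\<close>, the increment of \<open>ln\<close> over
    \<open>[n, n + 1]\<close> lies between the midpoint and the trapezoid values. The first makes
    \<open>d\<close> decrease. The second makes \<open>e\<close> increase, because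
    \<open>(n + 1/2) * (1/n + 1/(n+1)) / 2 - 1\<close> equals \<open>1/(4*n) - 1/(4*(n+1))\<close>.
    The common limit is squeezed between them.\<close>
  define d where "d = (\<lambda>n. ln (fact n) - ((real n + 1 / 2) * ln (real n) - real n))"
  define e where "e = (\<lambda>n. d n - 1 / (4 * real n))"
  have d_diff: "d n - d (Suc n) = (real n + 1 / 2) * (ln (real n + 1) - ln (real n)) - 1"
    if "n \<ge> 1" for n
  proof -
    have "ln (fact (Suc n) :: real) = ln (real n + 1) + ln (fact n)"
      by (simp add: ln_mult add_ac)
    then show ?thesis by (simp add: d_def algebra_simps)
  qed
  have d_dec: "d (Suc n) \<le> d n" if "n \<ge> 1" for n
  proof -
    have "2 * (real n + 1 - real n) / (real n + (real n + 1)) \<le> ln (real n + 1) - ln (real n)"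
      using that by (intro ln_inverse_approx_ge) auto
    then have "(real n + 1 / 2) * (2 / (2 * real n + 1))
        \<le> (real n + 1 / 2) * (ln (real n + 1) - ln (real n))"
      by (intro mult_left_mono) (simp_all add: add_ac)
    then show ?thesis using d_diff[OF that] by (simp add: field_simps)
  qed
  have e_inc: "e n \<le> e (Suc n)" if "n \<ge> 1" for n
  proof -
    have n: "real n > 0" using that by simp
    have "ln (real n + 1) - ln (real n) \<le> 1 * (inverse (real n) + inverse (real n + 1)) / 2"
      using n by (intro ln_inverse_approx_le) auto
    then have "(real n + 1 / 2) * (ln (real n + 1) - ln (real n))
        \<le> (real n + 1 / 2) * ((inverse (real n) + inverse (real n + 1)) / 2)"
      by (intro mult_left_mono) simp_all
    also have "\<dots> - 1 = 1 / (4 * real n) - 1 / (4 * (real n + 1))"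
      using n by (simp add: divide_simps) (simp add: algebra_simps)
    finally show ?thesis using d_diff[OF that] by (simp add: e_def add_ac)
  qed
  have dec: "decseq (\<lambda>n. d (Suc n))" by (rule decseq_SucI) (rule d_dec, simp)
  have inc: "incseq (\<lambda>n. e (Suc n))" by (rule incseq_SucI) (rule e_inc, simp)
  have ed: "e n \<le> d n" for n by (simp add: e_def)
  have "e (Suc 0) \<le> d (Suc n)" for n
    using incseqD[OF inc, of 0 n] ed[of "Suc n"] by simp
  then obtain c where c: "(\<lambda>n. d (Suc n)) \<longlonglongrightarrow> c" "\<And>n. c \<le> d (Suc n)"
    using decseq_convergent[OF dec, of "e (Suc 0)"] by auto
  have "(\<lambda>n. 1 / (4 * real (Suc n))) \<longlonglongrightarrow> 0"
    using tendsto_mult_left[OF LIMSEQ_inverse_real_of_nat, of "1/4"] by (simp add: field_simps)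
  then have "(\<lambda>n. e (Suc n)) \<longlonglongrightarrow> c - 0"
    unfolding e_def by (intro tendsto_diff c(1))
  then have e_le: "e (Suc n) \<le> c" for n
    using incseq_le[OF inc, of c n] by simp
  have "\<bar>d n - c\<bar> \<le> 1 / (4 * real n)" if "n \<ge> 1" for n
    using that c(2)[of "n - 1"] e_le[of "n - 1"] by (simp add: e_def abs_le_iff)
  then show thesis by (intro that[of c]) (simp add: d_def)
qed

lemma ln_diff_le:
  fixes u v r :: real
  assumes "r \<le> u" "r \<le> v" "r > 0"
  shows "\<bar>ln u - ln v\<bar> \<le> \<bar>u - v\<bar> / r"
proof -
  have *: "ln a - ln b \<le> \<bar>a - b\<bar> / r" if "r \<le> a" "r \<le> b" for a b :: real
  proof -
    have "ln a - ln b = ln (a / b)" using that assms by (simp add: ln_div)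
    also have "\<dots> \<le> a / b - 1" using that assms by (intro ln_le_minus_one) auto
    also have "\<dots> = (a - b) / b" using that assms by (simp add: field_simps)
    also have "\<dots> \<le> \<bar>a - b\<bar> / b" using that assms by (intro divide_right_mono) auto
    also have "\<dots> \<le> \<bar>a - b\<bar> / r" using that assms by (intro divide_left_mono) auto
    finally show ?thesis .
  qed
  show ?thesis using *[of u v] *[of v u] assms by (simp add: abs_minus_commute abs_le_iff)
qed

definition mag :: "nat \<Rightarrow> nat \<Rightarrow> real" where
  "mag N j = (2 * real j - real N) / real N"

text \<open>Besides the entropy, Stirling's formula produces a prefactor containing
  \<open>sqrt (1 - x^2)\<close>. Freezing it at \<open>x = m\<close> costs a multiple of
  \<open>\<bar>x - m\<bar>\<close>. On the stated range \<open>1 + x\<close> and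
  \<open>1 - x\<close> stay above \<open>(1 - \<bar>m\<bar>) / 2\<close>, so \<open>j\<close> and
  \<open>N - j\<close> are of order \<open>N\<close> and their Stirling errors are of order
  \<open>1 / N\<close>.\<close>

lemma binomial_local_asymptotics:
  fixes m :: real
  assumes "-1 < m" "m < 1"
  obtains \<kappa> L B :: real where "\<kappa> > 0" "L \<ge> 0" "B \<ge> 0"
    "\<And>N j. \<lbrakk>N \<ge> 1; j \<le> N; \<bar>mag N j - m\<bar> \<le> (1 - \<bar>m\<bar>) / 2\<rbrakk> \<Longrightarrow>
      \<bar>ln (\<kappa> * sqrt (real N) * (real (N choose j) / 2 ^ N)) + real N * Ifun (mag N j)\<bar>
        \<le> L * \<bar>mag N j - m\<bar> + B / real N"
proof -
  obtain c where c: "\<And>n. n \<ge> 1 \<Longrightarrow>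
      \<bar>ln (fact n) - ((real n + 1 / 2) * ln (real n) - real n) - c\<bar> \<le> 1 / (4 * real n)"
    using stirling_up_to_constant by blast
  define r where "r = (1 - \<bar>m\<bar>) / 2"
  have r: "r > 0" using assms by (simp add: r_def)
  \<comment> \<open>\<open>exp k = exp c * sqrt (1 - m^2) / 2\<close> is the inverse of the
    prefactor at \<open>x = m\<close>, up to the factor \<open>sqrt N\<close>.\<close>
  define k where "k = c - ln 2 + (ln (1 + m) + ln (1 - m)) / 2"
  define d where "d = (\<lambda>n. ln (fact n) - ((real n + 1 / 2) * ln (real n) - real n) - c)"
  show thesis
  proof (rule that[of "exp k" "1 / r" "1 / 4 + 1 / r"])
    fix N j :: nat
    assume N: "N \<ge> 1" and j: "j \<le> N" and near: "\<bar>mag N j - m\<bar> \<le> (1 - \<bar>m\<bar>) / 2"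
    define x where "x = mag N j"
    define n where "n = real N"
    have n: "n > 0" using N by (simp add: n_def)
    have xr: "r \<le> 1 + x" "r \<le> 1 - x" "r \<le> 1 + m" "r \<le> 1 - m"
      using near assms unfolding r_def x_def by (auto simp: abs_le_iff abs_if split: if_splits)
    have jx: "real j = n * (1 + x) / 2" "real (N - j) = n * (1 - x) / 2"
      using n j by (simp_all add: x_def mag_def n_def field_simps of_nat_diff)
    have j1: "j \<ge> 1"
    proof -
      have "real j > 0" unfolding jx using n xr r by simp
      then show ?thesis by simp
    qed
    have j2: "N - j \<ge> 1"
    proof -
      have "real (N - j) > 0" unfolding jx using n xr r by simp
      then show ?thesis by simp
    qed
    have lj: "ln (real j) = ln n + ln (1 + x) - ln 2" "ln (real (N - j)) = ln n + ln (1 - x) - ln 2"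
      unfolding jx using n xr r by (simp_all add: ln_div ln_mult)
    have lf: "ln (fact i) = d i + (real i + 1 / 2) * ln (real i) - real i + c" for i :: nat
      by (simp add: d_def)
    have "ln (real (N choose j)) = ln (fact N) - ln (fact j) - ln (fact (N - j))"
      using j by (simp add: binomial_fact ln_div ln_mult)
    then have "ln (real (N choose j)) = d N - d j - d (N - j) - c + (n + 1 / 2) * ln n
        - (n * (1 + x) / 2 + 1 / 2) * (ln n + ln (1 + x) - ln 2)
        - (n * (1 - x) / 2 + 1 / 2) * (ln n + ln (1 - x) - ln 2)"
      unfolding lf lj unfolding jx
      by (simp add: n_def algebra_simps add_divide_distrib diff_divide_distrib)
    then have bin: "ln (real (N choose j)) = d N - d j - d (N - j) - c - ln n / 2
        + (n + 1) * ln 2 - n * Ifun x - (ln (1 + x) + ln (1 - x)) / 2"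
      by (simp add: Ifun_def field_simps)
    have "ln (exp k * sqrt (real N) * (real (N choose j) / 2 ^ N))
        = k + ln n / 2 + ln (real (N choose j)) - n * ln 2"
      using n j by (simp add: ln_mult ln_div ln_realpow ln_sqrt n_def)
    then have *: "ln (exp k * sqrt (real N) * (real (N choose j) / 2 ^ N)) + real N * Ifun x
        = (d N - d j - d (N - j)) + (ln (1 + m) - ln (1 + x)) / 2 + (ln (1 - m) - ln (1 - x)) / 2"
      unfolding bin k_def by (simp add: n_def field_simps)
    define e f where "e = \<bar>x - m\<bar> / r" and "f = 1 / (2 * r) / n"
    have "\<bar>ln (1 + m) - ln (1 + x)\<bar> \<le> e" "\<bar>ln (1 - m) - ln (1 - x)\<bar> \<le> e"
      unfolding e_def using ln_diff_le[OF xr(3,1) r] ln_diff_le[OF xr(4,2) r] by (simp_all add: abs_minus_commute)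
    moreover have "\<bar>d N\<bar> \<le> 1 / 4 / n" using c[OF N] by (simp add: d_def n_def)
    moreover have "\<bar>d j\<bar> \<le> f"
    proof -
      have "1 / (4 * (n * (1 + x) / 2)) \<le> 1 / (4 * (n * r / 2))"
        using n r xr by (intro divide_left_mono mult_left_mono divide_right_mono) auto
      then show ?thesis using c[OF j1] unfolding d_def f_def jx by (simp add: mult_ac)
    qed
    moreover have "\<bar>d (N - j)\<bar> \<le> f"
    proof -
      have "1 / (4 * (n * (1 - x) / 2)) \<le> 1 / (4 * (n * r / 2))"
        using n r xr by (intro divide_left_mono mult_left_mono divide_right_mono) auto
      then show ?thesis using c[OF j2] unfolding d_def f_def jx by (simp add: mult_ac)
    qed
    moreover have "\<bar>u - v - w + a / 2 + b / 2\<bar> \<le> e + (g + 2 * f)"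
      if "\<bar>a\<bar> \<le> e" "\<bar>b\<bar> \<le> e" "\<bar>u\<bar> \<le> g" "\<bar>v\<bar> \<le> f" "\<bar>w\<bar> \<le> f" for a b u v w g :: real
      using that by linarith
    ultimately have "\<bar>(d N - d j - d (N - j)) + (ln (1 + m) - ln (1 + x)) / 2 + (ln (1 - m) - ln (1 - x)) / 2\<bar>
        \<le> e + (1 / 4 / n + 2 * f)"
      by blast
    moreover have "1 / 4 / n + 2 * f = (1 / 4 + 1 / r) / n"
      using n r by (simp add: f_def field_simps)
    ultimately show "\<bar>ln (exp k * sqrt (real N) * (real (N choose j) / 2 ^ N)) + real N * Ifun (mag N j)\<bar>
        \<le> 1 / r * \<bar>mag N j - m\<bar> + (1 / 4 + 1 / r) / real N"
      using * by (simp add: x_def n_def e_def)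
  qed (use r in auto)
qed

text \<open>A single term of the binomial expansion of \<open>(q + (1 - q)) ^ N\<close> is at most
  1, and for \<open>q = j / N\<close> its power part is exactly the exponential of the entropy over
  \<open>2 ^ N\<close>. This is the Chernoff bound at the optimal tilt; it holds up to the
  endpoints, where Stirling's formula gives no uniform control.\<close>

lemma binomial_entropy_bound:
  assumes "N \<ge> 1" "j \<le> N"
  shows "real (N choose j) / 2 ^ N \<le> exp (- real N * Ifun (mag N j))"
proof -
  define q where "q = real j / real N"
  have q: "0 \<le> q" "q \<le> 1" using assms by (simp_all add: q_def)
  have x: "1 + mag N j = 2 * q" "1 - mag N j = 2 * (1 - q)"
    using assms by (simp_all add: mag_def q_def field_simps)
  have qj: "real j = real N * q" "real (N - j) = real N * (1 - q)"
    using assms by (simp_all add: q_def of_nat_diff field_simps)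
  \<comment> \<open>For \<open>j = 0\<close> or \<open>j = N\<close> one of the bases vanishes, but
    so does its exponent; both sides are then 1.\<close>
  have exp_ln: "u ^ i * 2 ^ i = exp (real i * ln (2 * u))" if "u \<ge> 0" "u = 0 \<Longrightarrow> i = 0" for u :: real and i
    using that by (cases "u = 0") (simp_all add: exp_of_nat_mult power_mult_distrib)
  have "real (N choose j) * q ^ j * (1 - q) ^ (N - j)
      \<le> (\<Sum>k\<le>N. real (N choose k) * q ^ k * (1 - q) ^ (N - k))"
    using q assms by (intro member_le_sum) auto
  also have "\<dots> = (q + (1 - q)) ^ N" by (rule binomial_ring[symmetric])
  finally have 1: "real (N choose j) * (q ^ j * (1 - q) ^ (N - j)) \<le> 1" by (simp add: mult_ac)
  have "(q ^ j * (1 - q) ^ (N - j)) * 2 ^ N = (q ^ j * 2 ^ j) * ((1 - q) ^ (N - j) * 2 ^ (N - j))"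
    using assms by (simp add: power_add[symmetric] mult_ac)
  also have "\<dots> = exp (real j * ln (2 * q)) * exp (real (N - j) * ln (2 * (1 - q)))"
    using q assms by (subst (1 2) exp_ln) (auto simp: q_def field_simps)
  also have "\<dots> = exp (real N * Ifun (mag N j))"
    unfolding Ifun_def x qj by (simp add: exp_add[symmetric] field_simps)
  finally have 2: "q ^ j * (1 - q) ^ (N - j) = exp (real N * Ifun (mag N j)) / 2 ^ N"
    by (simp add: field_simps)
  show ?thesis using 1 unfolding 2 by (simp add: exp_minus field_simps)
qed

section \<open>Reduction of the spin model to weights on the binomial lattice\<close>

lemma sum_configs:
  fixes g :: "real \<Rightarrow> real"
  shows "(\<Sum>X\<in>configs N. g (S_N N X)) = (\<Sum>j\<le>N. real (N choose j) * g (2 * real j - real N))"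
proof -
  have S: "S_N N X = 2 * real (card {i. i < N \<and> X i = 1}) - real N" if "X \<in> configs N" for X
  proof -
    have "S_N N X = (\<Sum>i<N. 2 * (if X i = 1 then 1 else 0) - 1)"
      unfolding S_N_def using that
      by (intro sum.cong) (auto simp: configs_def PiE_iff)
    also have "\<dots> = 2 * (\<Sum>i<N. if X i = 1 then 1 else 0) - real N"
      by (simp add: sum_subtractf sum_distrib_left)
    also have "(\<Sum>i<N. if X i = 1 then 1 else 0 :: real) = real (card {i. i < N \<and> X i = 1})"
      by (simp add: sum.If_cases Int_def)
    finally show ?thesis .
  qed
  have "(\<Sum>X\<in>configs N. g (S_N N X)) = (\<Sum>M\<in>Pow {..<N}. g (2 * real (card M) - real N))"
    by (rule sum.reindex_bij_witness[where j = "\<lambda>X. {i. i < N \<and> X i = 1}"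
          and i = "\<lambda>M. \<lambda>i\<in>{..<N}. if i \<in> M then 1 else -1"])
       (auto simp: S configs_def PiE_iff extensional_def fun_eq_iff Ball_def)
  also have "\<dots> = (\<Sum>j\<le>N. \<Sum>M | M \<in> Pow {..<N} \<and> card M = j. g (2 * real (card M) - real N))"
    by (rule sum.group[symmetric]) (auto intro: order_trans[OF card_mono[of "{..<N}"]])
  also have "\<dots> = (\<Sum>j\<le>N. real (N choose j) * g (2 * real j - real N))"
    using n_subsets[of "{..<N}"] by (intro sum.cong refl) simp
  finally show ?thesis .
qed

text \<open>The total Curie-Weiss weight of all configurations with exactly \<open>j\<close> spins
  equal to 1.\<close>

definition lattice_weight :: "real \<Rightarrow> real \<Rightarrow> nat \<Rightarrow> nat \<Rightarrow> nat \<Rightarrow> real" where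
  "lattice_weight \<beta> h p N j =
     real (N choose j) * exp (real N * (\<beta> * mag N j ^ p + h * mag N j))"

text \<open>The \<open>p\<close>-fold interaction sum runs over all index tuples, repetitions
  included, so it factors as the \<open>p\<close>-th power of \<open>S_N\<close>.\<close>

lemma cw_weight_eq:
  assumes "N \<ge> 1"
  shows "cw_weight N \<beta> h p X
    = exp (real N * (\<beta> * (S_N N X / real N) ^ p + h * (S_N N X / real N)))"
proof -
  have "(\<Sum>\<iota>\<in>{..<p} \<rightarrow>\<^sub>E {..<N}. \<Prod>k<p. X (\<iota> k)) = S_N N X ^ p"
    using prod_sum_PiE[of "{..<p}" "\<lambda>_. {..<N}" "\<lambda>_. X"] by (simp add: S_N_def)
  moreover have "real N powr (1 - real p) = real N / real N ^ p"
    using assms by (simp add: powr_diff powr_realpow)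
  ultimately show ?thesis
    using assms by (simp add: cw_weight_def S_N_def[symmetric] power_divide algebra_simps)
qed

lemma sum_cw_weight:
  fixes P :: "real \<Rightarrow> bool"
  assumes "N \<ge> 1"
  shows "(\<Sum>X | X \<in> configs N \<and> P (S_N N X). cw_weight N \<beta> h p X)
    = (\<Sum>j | j \<le> N \<and> P (2 * real j - real N). lattice_weight \<beta> h p N j)"
proof -
  let ?e = "\<lambda>s. exp (real N * (\<beta> * (s / real N) ^ p + h * (s / real N)))"
  have fin: "finite (configs N)" unfolding configs_def by (intro finite_PiE) auto
  have "(\<Sum>X | X \<in> configs N \<and> P (S_N N X). cw_weight N \<beta> h p X)
      = (\<Sum>X\<in>configs N. if P (S_N N X) then ?e (S_N N X) else 0)"
    unfolding sum.inter_filter[OF fin] by (intro sum.cong refl) (simp only: cw_weight_eq[OF assms])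
  also have "\<dots> = (\<Sum>j\<le>N. real (N choose j) *
      (if P (2 * real j - real N) then ?e (2 * real j - real N) else 0))"
    by (rule sum_configs)
  also have "\<dots> = (\<Sum>j\<le>N. if P (2 * real j - real N) then lattice_weight \<beta> h p N j else 0)"
    by (intro sum.cong) (auto simp: lattice_weight_def mag_def)
  also have "\<dots> = (\<Sum>j | j \<in> {..N} \<and> P (2 * real j - real N). lattice_weight \<beta> h p N j)"
    by (rule sum.inter_filter[symmetric]) simp
  finally show ?thesis by simp
qed

lemma cw_partition_pos:
  assumes "N \<ge> 1"
  shows "2 ^ N * cw_Z N \<beta> h p > 0"
proof -
  have "2 ^ N * cw_Z N \<beta> h p = (\<Sum>j\<le>N. lattice_weight \<beta> h p N j)"
    using sum_cw_weight[OF assms, where P = "\<lambda>_. True" and \<beta> = \<beta> and h = h and p = p] by (simp add: cw_Z_def atMost_def)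
  also have "\<dots> > 0" by (intro sum_pos) (auto simp: lattice_weight_def)
  finally show ?thesis .
qed

lemma cw_cond_prob_eq:
  fixes P Q :: "real \<Rightarrow> bool"
  assumes "N \<ge> 1"
  shows "cw_cond_prob N \<beta> h p (\<lambda>X. P (S_N N X)) (\<lambda>X. Q (S_N N X))
    = (\<Sum>j | j \<le> N \<and> P (2 * real j - real N) \<and> Q (2 * real j - real N). lattice_weight \<beta> h p N j)
      / (\<Sum>j | j \<le> N \<and> Q (2 * real j - real N). lattice_weight \<beta> h p N j)"
  using less_imp_neq[OF cw_partition_pos[OF assms, of \<beta> h p]]
    sum_cw_weight[OF assms, where P = "\<lambda>s. P s \<and> Q s" and \<beta> = \<beta> and h = h and p = p]
    sum_cw_weight[OF assms, where P = Q and \<beta> = \<beta> and h = h and p = p]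
  by (simp add: cw_cond_prob_def cw_prob_def)

text \<open>Makes the unconditioned statements instances of the conditional ones, with the whole
  line as the neighborhood.\<close>

lemma cw_prob_eq_cond:
  assumes "N \<ge> 1"
  shows "cw_prob N \<beta> h p E = cw_cond_prob N \<beta> h p E (\<lambda>X. S_N N X / real N \<in> UNIV)"
  using cw_partition_pos[OF assms, of \<beta> h p]
  by (simp add: cw_cond_prob_def cw_prob_def) (simp add: cw_Z_def)

section \<open>Calculus of the rate function\<close>

text \<open>Explicit derivatives of \<open>H\<close> on the open interval. For \<open>k > p\<close> the exponent \<open>p - k\<close> is
  truncated, but then the coefficient of that term is zero.\<close>
definition Hd :: "real \<Rightarrow> real \<Rightarrow> nat \<Rightarrow> nat \<Rightarrow> real \<Rightarrow> real" where
  "Hd \<beta> h p k x = \<beta> * (\<Prod>i<k. real p - real i) * x ^ (p - k) +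
     (if k = 0 then h * x - Ifun x
      else if k = 1 then h - (ln (1 + x) - ln (1 - x)) / 2
      else - (fact (k - 2) * ((-1) ^ k / (1 + x) ^ (k - 1) + 1 / (1 - x) ^ (k - 1))) / 2)"

lemma Hd_0: "Hd \<beta> h p 0 = Hfun \<beta> h p"
  by (simp add: Hd_def Hfun_def fun_eq_iff)

lemma Hd_has_derivative:
  assumes "-1 < x" "x < 1"
  shows "(Hd \<beta> h p k has_real_derivative Hd \<beta> h p (Suc k) x) (at x)"
proof -
  have poly: "((\<lambda>x. \<beta> * (\<Prod>i<k. real p - real i) * x ^ (p - k)) has_real_derivative
      \<beta> * (\<Prod>i<Suc k. real p - real i) * x ^ (p - Suc k)) (at x)"
  proof -
    have "(\<Prod>i<Suc k. real p - real i) = (\<Prod>i<k. real p - real i) * real (p - k)"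
    proof (cases "k \<le> p")
      case False
      then have "(\<Prod>i<k. real p - real i) = 0" by (intro prod_zero) auto
      then show ?thesis by simp
    qed (simp add: of_nat_diff)
    then have "\<beta> * (\<Prod>i<Suc k. real p - real i) * x ^ (p - Suc k)
        = \<beta> * (\<Prod>i<k. real p - real i) * (real (p - k) * x ^ (p - k - Suc 0))"
      by (simp add: mult_ac del: prod.lessThan_Suc)
    then show ?thesis
      by (metis DERIV_cmult DERIV_pow)
  qed
  consider "k = 0" | "k = 1" | n where "k = Suc (Suc n)"
    by (cases k; cases "k - 1") auto
  then show ?thesis
  proof cases
    case 1
    have "((\<lambda>x. (1 + x) * ln (1 + x)) has_real_derivative ln (1 + x) + 1) (at x)"
      "((\<lambda>x. (1 - x) * ln (1 - x)) has_real_derivative - (ln (1 - x) + 1)) (at x)"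
      using assms by (auto intro!: derivative_eq_intros)
    then have "((\<lambda>x. h * x - Ifun x) has_real_derivative
        h - (ln (1 + x) + 1 + - (ln (1 - x) + 1)) / 2) (at x)"
      unfolding Ifun_def by (intro DERIV_diff DERIV_add DERIV_cdivide DERIV_cmult_Id)
    then have "((\<lambda>x. h * x - Ifun x) has_real_derivative h - (ln (1 + x) - ln (1 - x)) / 2) (at x)"
      by simp
    from DERIV_add[OF poly this] show ?thesis using 1 by (simp add: Hd_def[abs_def])
  next
    case 2
    have sign: "0 - (a - - b) / 2 = - (a + b) / 2" for a b :: real by (simp add: field_simps)
    have "((\<lambda>x. ln (1 + x)) has_real_derivative 1 / (1 + x)) (at x)"
      "((\<lambda>x. ln (1 - x)) has_real_derivative - (1 / (1 - x))) (at x)"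
      using assms by (auto intro!: derivative_eq_intros)
    then have "((\<lambda>x. h - (ln (1 + x) - ln (1 - x)) / 2) has_real_derivative
        0 - (1 / (1 + x) - - (1 / (1 - x))) / 2) (at x)"
      by (intro DERIV_diff DERIV_cdivide DERIV_const)
    then have "((\<lambda>x. h - (ln (1 + x) - ln (1 - x)) / 2) has_real_derivative
        - (1 / (1 + x) + 1 / (1 - x)) / 2) (at x)"
      by (rule DERIV_cong) (rule sign)
    from DERIV_add[OF poly this] show ?thesis using 2 by (simp add: Hd_def[abs_def])
  next
    case 3
    have "((\<lambda>x. inverse (1 + x)) has_real_derivative - (inverse (1 + x))\<^sup>2) (at x)"
      using assms by (auto intro!: derivative_eq_intros simp: power2_eq_square)
    from DERIV_power[OF this, of "Suc n"]
    have 1: "((\<lambda>x. inverse (1 + x) ^ Suc n) has_real_derivative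
        - (real (Suc n) * inverse (1 + x) ^ Suc (Suc n))) (at x)"
      by (simp add: power2_eq_square mult_ac)
    have "((\<lambda>x. inverse (1 - x)) has_real_derivative (inverse (1 - x))\<^sup>2) (at x)"
      using assms by (auto intro!: derivative_eq_intros simp: power2_eq_square)
    from DERIV_power[OF this, of "Suc n"]
    have 2: "((\<lambda>x. inverse (1 - x) ^ Suc n) has_real_derivative
        real (Suc n) * inverse (1 - x) ^ Suc (Suc n)) (at x)"
      by (simp add: power2_eq_square mult_ac)
    have "((\<lambda>x. - (fact n * ((-1) ^ k * inverse (1 + x) ^ Suc n + inverse (1 - x) ^ Suc n)) / 2)
      has_real_derivative - (fact n * ((-1) ^ k * - (real (Suc n) * inverse (1 + x) ^ Suc (Suc n))
        + real (Suc n) * inverse (1 - x) ^ Suc (Suc n))) / 2) (at x)"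
      by (intro DERIV_cdivide DERIV_minus DERIV_cmult DERIV_add 1 2)
    also have "- (fact n * ((-1) ^ k * - (real (Suc n) * inverse (1 + x) ^ Suc (Suc n))
        + real (Suc n) * inverse (1 - x) ^ Suc (Suc n))) / 2
      = - (fact (Suc n) * ((-1) ^ Suc k * inverse (1 + x) ^ Suc (Suc n) + inverse (1 - x) ^ Suc (Suc n))) / 2"
      by (simp add: algebra_simps)
    finally have *: "((\<lambda>x. - (fact n * ((-1) ^ k * inverse (1 + x) ^ Suc n + inverse (1 - x) ^ Suc n)) / 2)
      has_real_derivative - (fact (Suc n) * ((-1) ^ Suc k * inverse (1 + x) ^ Suc (Suc n)
        + inverse (1 - x) ^ Suc (Suc n))) / 2) (at x)" .
    have Hd_ge_2: "Hd \<beta> h p (Suc (Suc i)) y = \<beta> * (\<Prod>l<Suc (Suc i). real p - real l) * y ^ (p - Suc (Suc i))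
        + - (fact i * ((-1) ^ Suc (Suc i) * inverse (1 + y) ^ Suc i + inverse (1 - y) ^ Suc i)) / 2"
      for i and y :: real
      unfolding Hd_def divide_inverse power_inverse[symmetric] by simp
    show ?thesis
      using DERIV_add[OF poly *] unfolding 3 Hd_ge_2[abs_def] .
  qed
qed

text \<open>\<open>deriv\<close> at a point depends only on values nearby, so the induction has to
  carry the identity on the whole open interval.\<close>

lemma Hder_eq_Hd:
  assumes "-1 < x" "x < 1"
  shows "Hder k \<beta> h p x = Hd \<beta> h p k x"
  using assms
proof (induction k arbitrary: x)
  case 0
  then show ?case by (simp add: Hder_def Hd_0)
next
  case (Suc k)
  have "\<forall>\<^sub>F y in nhds x. Hder k \<beta> h p y = Hd \<beta> h p k y"
    using eventually_nhds_in_open[of "{-1<..<1}" x] Suc.prems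
    by (auto elim!: eventually_mono intro: Suc.IH)
  then have "deriv (Hder k \<beta> h p) x = deriv (Hd \<beta> h p k) x"
    by (intro deriv_cong_ev refl)
  also have "\<dots> = Hd \<beta> h p (Suc k) x"
    using Hd_has_derivative Suc.prems by (intro DERIV_imp_deriv)
  finally show ?case by (simp add: Hder_def)
qed

text \<open>Lagrange's remainder, with the derivative of order \<open>q + 1\<close> bounded by
  compactness: the interval of radius \<open>(1 - \<bar>m\<bar>) / 2\<close> keeps away from the
  singularities at -1 and 1. It serves both the derivative test at a maximizer and the local
  expansions with \<open>q = 2\<close> and \<open>q = 4\<close>.\<close>

lemma Hfun_taylor:
  assumes m: "-1 < m" "m < 1" and "q \<ge> 1"
    and zero: "\<And>k. 1 \<le> k \<Longrightarrow> k < q \<Longrightarrow> Hd \<beta> h p k m = 0"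
  obtains M where "M \<ge> 0" "\<And>x. \<bar>x - m\<bar> \<le> (1 - \<bar>m\<bar>) / 2 \<Longrightarrow>
    \<bar>Hfun \<beta> h p x - Hfun \<beta> h p m - Hd \<beta> h p q m / fact q * (x - m) ^ q\<bar> \<le> M * \<bar>x - m\<bar> ^ Suc q"
proof -
  define r where "r = (1 - \<bar>m\<bar>) / 2"
  have sub: "-1 < y \<and> y < 1" if "y \<in> {m - r..m + r}" for y
    using that m by (auto simp: r_def abs_if field_simps split: if_splits)
  have "continuous_on {m - r..m + r} (Hd \<beta> h p (Suc q))"
    using sub Hd_has_derivative
    by (intro continuous_at_imp_continuous_on ballI) (blast intro: DERIV_isCont)
  then have "bounded (Hd \<beta> h p (Suc q) ` {m - r..m + r})"
    by (intro compact_imp_bounded compact_continuous_image compact_Icc)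
  then obtain M where M: "M > 0" "\<And>y. y \<in> {m - r..m + r} \<Longrightarrow> \<bar>Hd \<beta> h p (Suc q) y\<bar> \<le> M"
    unfolding bounded_pos by auto
  show thesis
  proof (rule that[of M])
    fix x assume x: "\<bar>x - m\<bar> \<le> (1 - \<bar>m\<bar>) / 2"
    show "\<bar>Hfun \<beta> h p x - Hfun \<beta> h p m - Hd \<beta> h p q m / fact q * (x - m) ^ q\<bar> \<le> M * \<bar>x - m\<bar> ^ Suc q"
    proof (cases "x = m")
      case False
      have xI: "m - r \<le> x" "x \<le> m + r" using abs_le_D1[OF x] abs_le_D2[OF x] unfolding r_def by linarith+
      have "\<exists>t. (if x < m then x < t \<and> t < m else m < t \<and> t < x) \<and>
          Hfun \<beta> h p x = (\<Sum>k<Suc q. Hd \<beta> h p k m / fact k * (x - m) ^ k)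
            + Hd \<beta> h p (Suc q) t / fact (Suc q) * (x - m) ^ Suc q"
        using False xI m sub by (intro Taylor[where a = "m - r" and b = "m + r"])
          (auto simp: Hd_0 r_def intro!: Hd_has_derivative)
      then obtain t where t: "if x < m then x < t \<and> t < m else m < t \<and> t < x"
        and eq: "Hfun \<beta> h p x = (\<Sum>k<Suc q. Hd \<beta> h p k m / fact k * (x - m) ^ k)
            + Hd \<beta> h p (Suc q) t / fact (Suc q) * (x - m) ^ Suc q" by blast
      have "(\<Sum>k<q. Hd \<beta> h p k m / fact k * (x - m) ^ k) = (\<Sum>k\<in>{0}. Hd \<beta> h p k m / fact k * (x - m) ^ k)"
        using \<open>q \<ge> 1\<close> zero by (intro sum.mono_neutral_right) auto
      then have "Hfun \<beta> h p x - Hfun \<beta> h p m - Hd \<beta> h p q m / fact q * (x - m) ^ q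
          = Hd \<beta> h p (Suc q) t / fact (Suc q) * (x - m) ^ Suc q"
        using eq by (simp add: Hd_0)
      moreover have "\<bar>Hd \<beta> h p (Suc q) t / fact (Suc q) * (x - m) ^ Suc q\<bar> \<le> M * \<bar>x - m\<bar> ^ Suc q"
      proof -
        have "\<bar>Hd \<beta> h p (Suc q) t\<bar> \<le> M" using t xI by (intro M) (auto split: if_splits)
        moreover have "(1::real) \<le> fact (Suc q)" by (rule fact_ge_1)
        ultimately have "\<bar>Hd \<beta> h p (Suc q) t\<bar> / fact (Suc q) \<le> M / 1"
          using M by (intro frac_le) auto
        then show ?thesis
          unfolding abs_mult power_abs by (intro mult_right_mono) auto
      qed
      ultimately show ?thesis by simp
    qed (use \<open>q \<ge> 1\<close> in \<open>simp add: power_0_left\<close>)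
  qed (use M in simp)
qed

lemma nonpos_if_le_linear:
  fixes b M \<delta> :: real
  assumes "\<delta> > 0" and "\<And>e. 0 < e \<Longrightarrow> e \<le> \<delta> \<Longrightarrow> b \<le> M * e"
  shows "b \<le> 0"
proof (rule tendsto_lowerbound)
  show "((\<lambda>e. M * e) \<longlongrightarrow> 0) (at_right 0)" by (auto intro!: tendsto_eq_intros)
  show "\<forall>\<^sub>F e in at_right 0. b \<le> M * e"
    using eventually_at_right_less[of "0::real"] eventually_at_right[of 0 \<delta>] assms
    by (auto intro!: exI[of _ \<delta>] simp: eventually_at_right[of 0 1])
qed simp

text \<open>Along \<open>m + s * e\<close> with \<open>s = 1\<close> or \<open>s = - 1\<close> the
  leading change of \<open>H\<close> is \<open>b * s ^ q * e ^ q\<close>, and maximality keeps it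
  below a remainder of order \<open>e ^ (q + 1)\<close>. The right side gives
  \<open>b \<le> 0\<close>; for odd \<open>q\<close> the left side gives the opposite sign.\<close>

lemma global_max_derivs:
  assumes m: "-1 < m" "m < 1" and "q \<ge> 1" and max: "global_max \<beta> h p m"
    and zero: "\<And>k. 1 \<le> k \<Longrightarrow> k < q \<Longrightarrow> Hd \<beta> h p k m = 0"
  shows "Hd \<beta> h p q m \<le> 0" and "odd q \<Longrightarrow> Hd \<beta> h p q m = 0"
proof -
  obtain M where M: "M \<ge> 0" "\<And>x. \<bar>x - m\<bar> \<le> (1 - \<bar>m\<bar>) / 2 \<Longrightarrow>
    \<bar>Hfun \<beta> h p x - Hfun \<beta> h p m - Hd \<beta> h p q m / fact q * (x - m) ^ q\<bar> \<le> M * \<bar>x - m\<bar> ^ Suc q"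
    using Hfun_taylor[OF m \<open>q \<ge> 1\<close> zero] by blast
  define b where "b = Hd \<beta> h p q m / fact q"
  define \<delta> where "\<delta> = (1 - \<bar>m\<bar>) / 2"
  have \<delta>: "\<delta> > 0" using m by (simp add: \<delta>_def)
  have *: "b * s ^ q \<le> M * e" if "0 < e" "e \<le> \<delta>" "\<bar>s\<bar> = 1" for e s
  proof -
    define x where "x = m + s * e"
    have xm: "\<bar>x - m\<bar> = e" using that by (simp add: x_def abs_mult)
    then have "x \<in> {-1..1}" using that m by (auto simp: \<delta>_def abs_if split: if_splits)
    then have "Hfun \<beta> h p x \<le> Hfun \<beta> h p m" using max by (simp add: global_max_def)
    moreover have "\<bar>Hfun \<beta> h p x - Hfun \<beta> h p m - b * (x - m) ^ q\<bar> \<le> M * e ^ Suc q"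
      using M(2)[of x] xm that by (simp add: \<delta>_def b_def)
    ultimately have "b * (x - m) ^ q \<le> M * e ^ Suc q" by linarith
    then have "(b * s ^ q) * e ^ q \<le> (M * e) * e ^ q"
      by (simp add: x_def power_mult_distrib mult_ac)
    then show ?thesis using that by (simp add: mult_le_cancel_right)
  qed
  have b: "b \<le> 0" using nonpos_if_le_linear[OF \<delta>, of b M] *[of _ 1] by simp
  then have "b * fact q \<le> 0" by (simp add: mult_nonpos_nonneg)
  then show "Hd \<beta> h p q m \<le> 0" by (simp add: b_def)
  have "- b \<le> 0" if "odd q"
    using nonpos_if_le_linear[OF \<delta>, of "- b" M] *[of _ "-1"] that by simp
  then show "Hd \<beta> h p q m = 0" if "odd q"
    using that b by (auto simp: b_def)
qed

section \<open>Continuity up to the endpoints and location of the maximizers\<close>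

lemma continuous_on_mult_ln: "continuous_on {0..} (\<lambda>y::real. y * ln y)"
proof -
  have "((\<lambda>y::real. y * ln y) \<longlongrightarrow> 0) (at_right 0)" by real_asymp
  then show ?thesis
    unfolding continuous_on_def
  proof (intro ballI)
    fix x :: real assume "x \<in> {0..}"
    show "((\<lambda>y. y * ln y) \<longlongrightarrow> x * ln x) (at x within {0..})"
    proof (cases "x = 0")
      case True
      then show ?thesis
        using \<open>((\<lambda>y::real. y * ln y) \<longlongrightarrow> 0) (at_right 0)\<close> by (simp add: at_within_Ici_at_right)
    next
      case False
      then have "isCont (\<lambda>y. y * ln y) x" by (intro continuous_intros) auto
      then show ?thesis
        using continuous_at_imp_continuous_at_within continuous_within by blast
    qed
  qed
qed

lemma continuous_on_Hfun: "continuous_on {-1..1} (Hfun \<beta> h p)"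
proof -
  have "continuous_on {-1..1} (\<lambda>x::real. (1 + x) * ln (1 + x))"
    by (rule continuous_on_compose2[OF continuous_on_mult_ln]) (auto intro!: continuous_intros)
  moreover have "continuous_on {-1..1} (\<lambda>x::real. (1 - x) * ln (1 - x))"
    by (rule continuous_on_compose2[OF continuous_on_mult_ln]) (auto intro!: continuous_intros)
  ultimately have "continuous_on {-1..1} Ifun"
    unfolding Ifun_def[abs_def] by (intro continuous_on_divide continuous_on_add continuous_on_const) auto
  then show ?thesis
    unfolding Hfun_def[abs_def] by (intro continuous_intros)
qed

lemma Hfun_gap:
  assumes "closed T" and "\<And>x. x \<in> T \<Longrightarrow> x \<in> {-1..1} \<Longrightarrow> Hfun \<beta> h p x < c"
  obtains \<eta> where "\<eta> > 0" "\<And>x. x \<in> T \<Longrightarrow> x \<in> {-1..1} \<Longrightarrow> Hfun \<beta> h p x \<le> c - \<eta>"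
proof (cases "T \<inter> {-1..1} = {}")
  case True
  then show thesis by (intro that[of 1]) auto
next
  case False
  have "compact (T \<inter> {-1..1})" using assms(1) by (intro closed_Int_compact compact_Icc)
  then obtain x0 where "x0 \<in> T \<inter> {-1..1}"
    "\<And>x. x \<in> T \<inter> {-1..1} \<Longrightarrow> Hfun \<beta> h p x \<le> Hfun \<beta> h p x0"
    using continuous_attains_sup[OF _ False continuous_on_subset[OF continuous_on_Hfun]] by blast
  then show thesis using assms(2)[of x0] by (intro that[of "c - Hfun \<beta> h p x0"]) auto
qed

text \<open>The entropy has infinite slope at 1, which excludes that endpoint. A negative point
  loses to its reflection because \<open>h > 0\<close>, and at 0 the first derivative is
  \<open>h\<close>.\<close>

lemma global_max_interior:
  assumes "p \<ge> 3" "\<beta> > 0" "h > 0" and max: "global_max \<beta> h p m"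
  shows "0 < m" "m < 1"
proof -
  have le: "Hfun \<beta> h p x \<le> Hfun \<beta> h p m" if "x \<in> {-1..1}" for x
    using max that by (simp add: global_max_def)
  have mI: "-1 \<le> m" "m \<le> 1" using max by (auto simp: global_max_def)
  have "m \<noteq> 1"
  proof
    assume "m = 1"
    \<comment> \<open>Moving from 1 to \<open>1 - 2 * u\<close> loses at most
      \<open>2 * \<beta> * p * u\<close> by Bernoulli's inequality, and \<open>2 * h * u\<close>
      from the field, while the entropy gains at least \<open>- u * ln u\<close>. The exponent is
      chosen so that a net gain of \<open>u\<close> remains.\<close>
    define u where "u = exp (- (2 * \<beta> * real p + 2 * h + 1))"
    have "2 * \<beta> * real p > 0" using assms by simp
    then have "2 * \<beta> * real p + 2 * h + 1 \<ge> 1" using assms by linarith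
    then have "2 \<le> exp (2 * \<beta> * real p + 2 * h + 1)"
      using exp_ge_add_one_self[of "2 * \<beta> * real p + 2 * h + 1"] by linarith
    then have "u \<le> 1 / 2" unfolding u_def exp_minus by (simp add: field_simps)
    then have u: "0 < u" "u \<le> 1 / 2" "ln u = - (2 * \<beta> * real p + 2 * h + 1)"
      by (simp_all add: u_def)
    have "1 + real p * (- 2 * u) \<le> (1 + (- 2 * u)) ^ p"
      using u by (intro Bernoulli_inequality) auto
    then have "\<beta> * (1 - 2 * u * real p) \<le> \<beta> * (1 - 2 * u) ^ p"
      using assms by (intro mult_left_mono) (simp_all add: mult_ac)
    moreover have "Ifun (1 - 2 * u) = ln 2 + (1 - u) * ln (1 - u) + u * ln u"
    proof -
      have "1 + (1 - 2 * u) = 2 * (1 - u)" "1 - (1 - 2 * u) = 2 * u" by simp_all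
      then show ?thesis
        unfolding Ifun_def using u(1,2) by (simp only: ln_mult) (simp add: ln_mult field_simps)
    qed
    moreover have "(1 - u) * ln (1 - u) \<le> 0"
      using u by (intro mult_nonneg_nonpos) auto
    moreover have "Ifun 1 = ln 2" by (simp add: Ifun_def)
    moreover have "u * ln u = - 2 * \<beta> * u * real p - 2 * h * u - u"
      unfolding u(3) by (simp add: algebra_simps)
    ultimately have "Hfun \<beta> h p (1 - 2 * u) - Hfun \<beta> h p 1 \<ge> u"
      by (simp add: Hfun_def algebra_simps)
    then show False using le[of "1 - 2 * u"] u \<open>m = 1\<close> by simp
  qed
  then show "m < 1" using mI by simp
  have "m \<ge> 0"
  proof (rule ccontr)
    assume "\<not> m \<ge> 0"
    then have "m < 0" by simp
    have "m ^ p \<le> \<bar>m\<bar> ^ p" using abs_ge_self[of "m ^ p"] by (simp add: power_abs)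
    then have "\<beta> * m ^ p \<le> \<beta> * (- m) ^ p" using assms \<open>m < 0\<close> by simp
    moreover have "h * m < h * (- m)" using mult_pos_neg[OF \<open>h > 0\<close> \<open>m < 0\<close>] by simp
    moreover have "Ifun (- m) = Ifun m" by (simp add: Ifun_def add.commute)
    ultimately have "Hfun \<beta> h p m < Hfun \<beta> h p (- m)" by (simp add: Hfun_def)
    then show False using le[of "- m"] mI by simp
  qed
  moreover have "m \<noteq> 0"
  proof
    assume "m = 0"
    then have "Hd \<beta> h p 1 0 = 0"
      using global_max_derivs(2)[of 0 1 \<beta> h p] max by simp
    then show False using assms by (simp add: Hd_def zero_power)
  qed
  ultimately show "0 < m" by simp
qed

section \<open>Nondegeneracy at critical points and the fourth derivative at special points\<close>

lemma Hd_2_eq: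
  assumes "-1 < x" "x < 1"
  shows "Hd \<beta> h p 2 x = \<beta> * real p * (real p - 1) * x ^ (p - 2) - 1 / (1 - x\<^sup>2)"
proof -
  define z where "z = 1 - x\<^sup>2"
  have z: "z = (1 + x) * (1 - x)" by (simp add: z_def power2_eq_square algebra_simps)
  have "1 + x \<noteq> 0" "1 - x \<noteq> 0" using assms by auto
  then have "1 / (1 + x) + 1 / (1 - x) = 2 / z"
    unfolding z by (subst add_frac_eq) auto
  then have "(1 / (1 + x) + 1 / (1 - x)) / 2 = 1 / (1 - x\<^sup>2)"
    by (simp add: z_def[symmetric])
  moreover define a b where "a = 1 / (1 + x)" and "b = 1 / (1 - x)"
  have "Hd \<beta> h p 2 x = \<beta> * real p * (real p - 1) * x ^ (p - 2) - (a + b) / 2"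
    by (simp add: Hd_def numeral_2_eq_2 a_def[symmetric] b_def[symmetric] field_simps)
  ultimately show ?thesis by (simp only: a_def b_def)
qed

text \<open>Zeros of the second derivative are points where \<open>x ^ (p - 2) * (1 - x\<^sup>2)\<close> takes a fixed value,
  and this function is unimodal on the unit interval.\<close>
lemma Hd_2_no_three_zeros:
  assumes "p \<ge> 3" "\<beta> > 0" and x: "0 < x" "x < y" "y < z" "z < 1"
    and zero: "Hd \<beta> h p 2 x = 0" "Hd \<beta> h p 2 y = 0" "Hd \<beta> h p 2 z = 0"
  shows False
proof -
  define G where "G = (\<lambda>x::real. x ^ (p - 2) - x ^ p)"
  define G' where "G' = (\<lambda>x::real. x ^ (p - 3) * (real (p - 2) - real p * x\<^sup>2))"
  have der: "(G has_real_derivative G' u) (at u)" for u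
  proof -
    have "(G has_real_derivative real (p - 2) * u ^ (p - 2 - 1) - real p * u ^ (p - 1)) (at u)"
      unfolding G_def by (auto intro!: derivative_eq_intros)
    moreover have "p - 2 - 1 = p - 3" "p - 1 = (p - 3) + 2" using assms by auto
    ultimately show ?thesis by (simp add: G'_def power_add power2_eq_square algebra_simps)
  qed
  have val: "G u = 1 / (\<beta> * real p * (real p - 1))"
    if "0 < u" "u < 1" "Hd \<beta> h p 2 u = 0" for u
  proof -
    have "u\<^sup>2 < 1" using that by (simp add: abs_square_less_1)
    then have "\<beta> * real p * (real p - 1) * (u ^ (p - 2) * (1 - u\<^sup>2)) = 1"
      using that Hd_2_eq[of u \<beta> h p] by (simp add: field_simps)
    moreover have "u ^ (p - 2) * (1 - u\<^sup>2) = G u"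
    proof -
      have "p = (p - 2) + 2" using assms by simp
      then have "u ^ p = u ^ (p - 2) * u\<^sup>2" by (metis power_add)
      then show ?thesis by (simp add: G_def right_diff_distrib)
    qed
    ultimately have "G u * (\<beta> * real p * (real p - 1)) = 1" by (simp add: mult_ac)
    moreover have "\<beta> * real p * (real p - 1) \<noteq> 0" using assms by simp
    ultimately show ?thesis by (metis nonzero_eq_divide_eq)
  qed
  \<comment> \<open>Three equal values force two distinct positive zeros of \<open>G'\<close>, whose
    only positive zero is \<open>sqrt ((p - 2) / p)\<close>.\<close>
  have "G y - G x = 0" "G z - G y = 0" using x zero by (simp_all add: val)
  then obtain v w where v: "x < v" "v < y" "G' v = 0" and w: "y < w" "w < z" "G' w = 0"
    using MVT2[OF x(2), of G G'] MVT2[OF x(3), of G G'] der x by auto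
  have "real p * v\<^sup>2 = real p * w\<^sup>2" using v w x by (simp add: G'_def)
  then have "v = w" using v w x assms by (simp add: power2_eq_iff)
  then show False using v w by simp
qed

text \<open>Equal heights at the two maximizers \<open>a < b\<close> give a further zero
  \<open>y\<close> of \<open>H'\<close> between them, hence zeros \<open>u < v\<close> of
  \<open>H''\<close> on either side of \<open>y\<close>. Degeneracy of \<open>m\<close>, which is
  \<open>a\<close> or \<open>b\<close>, would add a third one outside \<open>[u, v]\<close>.\<close>

lemma critical_Hd_2_neg:
  assumes p: "p \<ge> 3" "\<beta> > 0" "h > 0"
    and m: "global_max \<beta> h p m" and m': "global_max \<beta> h p m'" "m' \<noteq> m"
  shows "Hd \<beta> h p 2 m < 0"
proof -
  note int = global_max_interior[OF p]
  have d1: "Hd \<beta> h p 1 u = 0" if "global_max \<beta> h p u" for u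
    by (rule global_max_derivs(2)[OF _ _ _ that]) (use int[OF that] in auto)
  have "Hd \<beta> h p 2 m \<noteq> 0"
  proof
    assume z: "Hd \<beta> h p 2 m = 0"
    define a b where "a = min m m'" and "b = max m m'"
    have ab: "0 < a" "a < b" "b < 1" using int[OF m] int[OF m'(1)] m'(2) by (auto simp: a_def b_def)
    have mx: "global_max \<beta> h p a" "global_max \<beta> h p b" using m m' by (auto simp: a_def b_def min_def max_def)
    have der: "(Hd \<beta> h p k has_real_derivative Hd \<beta> h p (Suc k) u) (at u)" if "a \<le> u" "u \<le> b" for k u
      using that ab by (intro Hd_has_derivative) auto
    have "Hd \<beta> h p 0 b - Hd \<beta> h p 0 a = 0"
      using mx by (auto simp: Hd_0 global_max_def intro: antisym)
    then obtain y where y: "a < y" "y < b" "Hd \<beta> h p 1 y = 0"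
      using MVT2[OF ab(2), of "Hd \<beta> h p 0" "Hd \<beta> h p (Suc 0)"] der ab by auto
    obtain u where u: "a < u" "u < y" "Hd \<beta> h p 2 u = 0"
      using MVT2[OF y(1), of "Hd \<beta> h p 1" "Hd \<beta> h p (Suc 1)"] der[of _ 1] y d1[OF mx(1)]
      by (auto simp: numeral_2_eq_2)
    obtain v where v: "y < v" "v < b" "Hd \<beta> h p 2 v = 0"
      using MVT2[OF y(2), of "Hd \<beta> h p 1" "Hd \<beta> h p (Suc 1)"] der[of _ 1] y d1[OF mx(2)]
      by (auto simp: numeral_2_eq_2)
    have "m = a \<or> m = b" by (auto simp: a_def b_def min_def max_def)
    then show False
      using Hd_2_no_three_zeros[OF p(1,2), of a u v h] Hd_2_no_three_zeros[OF p(1,2), of u v b h]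
        ab y u v z by auto
  qed
  moreover have "Hd \<beta> h p 2 m \<le> 0"
  proof (rule global_max_derivs(1)[OF _ _ _ m])
    fix k :: nat assume "1 \<le> k" "k < 2"
    then have "k = 1" by simp
    then show "Hd \<beta> h p k m = 0" using d1[OF m] by simp
  qed (use int[OF m] in auto)
  ultimately show ?thesis by simp
qed

text \<open>The third derivative vanishes by the test of odd order. For the fourth, put
  \<open>u = m^2\<close> and multiply by powers of \<open>m\<close> until only
  \<open>m ^ (p - 2)\<close> occurs. The second derivative then gives \<open>B = 1 / (1 - u)\<close>
  and the third \<open>(p - 2) * (1 - u) = 2 * u\<close>; eliminating \<open>\<beta>\<close> and
  \<open>p\<close> leaves \<open>- 4 * u / (1 - u) ^ 3\<close> for the fourth derivative times
  \<open>u\<close>.\<close>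

lemma special_derivs:
  assumes p: "p \<ge> 3" and m: "-1 < m" "m < 1" "global_max \<beta> h p m" and d2: "Hd \<beta> h p 2 m = 0"
  shows "Hd \<beta> h p 3 m = 0" and "Hd \<beta> h p 4 m < 0"
proof -
  have d1: "Hd \<beta> h p 1 m = 0"
    by (rule global_max_derivs(2)[OF _ _ _ m(3)]) (use m in auto)
  show d3: "Hd \<beta> h p 3 m = 0"
  proof (rule global_max_derivs(2)[OF m(1,2) _ m(3)])
    fix k :: nat assume "1 \<le> k" "k < 3"
    then have "k = 1 \<or> k = 2" by auto
    then show "Hd \<beta> h p k m = 0" using d1 d2 by auto
  qed auto
  define u where "u = m\<^sup>2"
  have u1: "u < 1" using m by (simp add: u_def abs_square_less_1 abs_less_iff)
  \<comment> \<open>At 0 the power term vanishes because \<open>p \<ge> 3\<close>, and the second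
    derivative is -1.\<close>
  have "m \<noteq> 0"
  proof
    assume "m = 0"
    then show False using d2 p Hd_2_eq[of 0 \<beta> h p] by (simp add: zero_power)
  qed
  then have u0: "u > 0" by (simp add: u_def)
  define B where "B = \<beta> * real p * (real p - 1) * m ^ (p - 2)"
  have ne: "1 + m \<noteq> 0" "1 - m \<noteq> 0" using m by auto
  have uu: "1 - u = (1 + m) * (1 - m)" by (simp add: u_def power2_eq_square algebra_simps)
  have B: "B = 1 / (1 - u)" using d2 Hd_2_eq[OF m(1,2), of \<beta> h p] by (simp add: B_def u_def)
  have "m ^ (p - 3) * m = m ^ (p - 2)"
    using p by (metis Suc_diff_le diff_Suc_Suc eval_nat_numeral(3) numeral_2_eq_2 power_Suc2)
  note pow = this
  define D where "D = 1 / (1 - m)\<^sup>2 - 1 / (1 + m)\<^sup>2"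
  have H3: "Hd \<beta> h p 3 m = \<beta> * real p * (real p - 1) * (real p - 2) * m ^ (p - 3) - D / 2"
    by (simp add: Hd_def D_def eval_nat_numeral diff_divide_distrib)
  then have "Hd \<beta> h p 3 m * m
      = \<beta> * real p * (real p - 1) * (real p - 2) * (m ^ (p - 3) * m) - m * D / 2"
    unfolding H3 by (simp add: algebra_simps)
  then have "Hd \<beta> h p 3 m * m = (real p - 2) * B - m * D / 2"
    unfolding pow by (simp add: B_def)
  also have "m * D / 2 = 2 * u / (1 - u)\<^sup>2"
    unfolding uu D_def using ne by (simp add: divide_simps) (simp add: u_def power2_eq_square algebra_simps)
  finally have H3m: "Hd \<beta> h p 3 m * m = (real p - 2) * B - 2 * u / (1 - u)\<^sup>2" .
  have p2: "(real p - 2) * (1 - u) = 2 * u"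
  proof -
    have "(real p - 2) * (1 - u) = ((real p - 2) * B) * (1 - u)\<^sup>2"
      using u1 by (simp add: B power2_eq_square)
    also have "(real p - 2) * B = 2 * u / (1 - u)\<^sup>2" using H3m d3 by simp
    finally show ?thesis using u1 by simp
  qed
  then have p3: "(real p - 3) * (1 - u) = 3 * u - 1" by (simp add: algebra_simps)
  \<comment> \<open>For \<open>p = 3\<close> the exponent \<open>p - 4\<close> is truncated to 0,
    but the coefficient \<open>p - 3\<close> is zero on both sides.\<close>
  have "(real p - 3) * m ^ (p - 4) * m\<^sup>2 = (real p - 3) * m ^ (p - 2)"
  proof (cases "p = 3")
    case False
    then have "p - 2 = (p - 4) + 2" using p by simp
    then show ?thesis by (metis mult.assoc power_add)
  qed simp
  note pow = this
  define E where "E = 1 / (1 + m) ^ 3 + 1 / (1 - m) ^ 3"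
  have H4: "Hd \<beta> h p 4 m
      = \<beta> * real p * (real p - 1) * (real p - 2) * ((real p - 3) * m ^ (p - 4)) - E"
    by (simp add: Hd_def E_def eval_nat_numeral)
  then have "Hd \<beta> h p 4 m * u
      = \<beta> * real p * (real p - 1) * (real p - 2) * ((real p - 3) * m ^ (p - 4) * m\<^sup>2) - u * E"
    unfolding H4 by (simp add: u_def algebra_simps)
  then have "Hd \<beta> h p 4 m * u = (real p - 2) * (real p - 3) * B - u * E"
    unfolding pow by (simp add: B_def)
  also have "E = (2 + 6 * u) / (1 - u) ^ 3"
    unfolding uu E_def using ne
    by (simp add: divide_simps) (simp add: u_def power2_eq_square power3_eq_cube algebra_simps)
  also have "(real p - 2) * (real p - 3) * B
      = ((real p - 2) * (1 - u)) * ((real p - 3) * (1 - u)) / (1 - u) ^ 3"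
    using u1 by (simp add: B power3_eq_cube)
  also have "\<dots> - u * ((2 + 6 * u) / (1 - u) ^ 3) = - 4 * u / (1 - u) ^ 3"
    unfolding p2 p3 using u1 by (simp add: field_simps)
  finally have "Hd \<beta> h p 4 m * u < 0" using u0 u1 by (simp add: divide_neg_pos)
  then show "Hd \<beta> h p 4 m < 0" using u0 by (simp add: mult_less_0_iff)
qed

section \<open>Local limit estimates\<close>

lemma power_le_fact_exp:
  fixes z :: real
  assumes "z \<ge> 0"
  shows "z ^ n \<le> fact n * exp z"
proof -
  have "(\<Sum>k\<in>{n}. inverse (fact k) * z ^ k) \<le> exp z"
    unfolding exp_def using assms summable_exp[of z]
    by (intro order_trans[OF sum_le_suminf]) (auto simp: divide_inverse mult.commute)
  then show ?thesis by (simp add: field_simps)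
qed

lemma power_times_exp_bounded:
  fixes a :: real
  assumes "a > 0" "even q" "q \<ge> 2"
  obtains K where "K \<ge> 0" "\<And>t::real. \<bar>t\<bar> ^ n * exp (- a * t ^ q) \<le> K"
proof (rule that[of "exp a * (fact n / a ^ n)"])
  fix t :: real
  \<comment> \<open>This weakens the decay to \<open>exp a * exp (- a * \<bar>t\<bar>)\<close>,
    which one term of the exponential series controls for every \<open>q\<close>.\<close>
  have "\<bar>t\<bar> - 1 \<le> \<bar>t\<bar> ^ q"
  proof (cases "\<bar>t\<bar> \<ge> 1")
    case True
    then show ?thesis using self_le_power[of "\<bar>t\<bar>" q] assms by simp
  next
    case False
    moreover have "0 \<le> \<bar>t\<bar> ^ q" by simp
    ultimately show ?thesis by linarith
  qed
  then have "a * (\<bar>t\<bar> - 1) \<le> a * t ^ q"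
    using assms by (simp add: power_even_abs)
  then have "exp (- a * t ^ q) \<le> exp a * exp (- (a * \<bar>t\<bar>))"
    by (simp add: exp_add[symmetric] algebra_simps)
  then have "\<bar>t\<bar> ^ n * exp (- a * t ^ q) \<le> \<bar>t\<bar> ^ n * (exp a * exp (- (a * \<bar>t\<bar>)))"
    by (intro mult_left_mono) auto
  also have "\<dots> = exp a * ((a * \<bar>t\<bar>) ^ n * exp (- (a * \<bar>t\<bar>)) / a ^ n)"
    using assms by (simp add: power_mult_distrib)
  also have "(a * \<bar>t\<bar>) ^ n * exp (- (a * \<bar>t\<bar>)) \<le> fact n"
    using power_le_fact_exp[of "a * \<bar>t\<bar>" n] assms by (simp add: exp_minus field_simps)
  then have "exp a * ((a * \<bar>t\<bar>) ^ n * exp (- (a * \<bar>t\<bar>)) / a ^ n) \<le> exp a * (fact n / a ^ n)"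
    using assms by (intro mult_left_mono divide_right_mono) auto
  finally show "\<bar>t\<bar> ^ n * exp (- a * t ^ q) \<le> exp a * (fact n / a ^ n)" .
qed (use assms in auto)

lemma power_exp_envelope:
  fixes a :: real
  assumes "a > 0" "even q" "q \<ge> 2"
  obtains K where "K \<ge> 0" "\<And>t::real. \<bar>t\<bar> ^ n * exp (- a * t ^ q) \<le> K / (1 + t\<^sup>2)"
proof -
  obtain K1 where K1: "K1 \<ge> 0" "\<And>t::real. \<bar>t\<bar> ^ n * exp (- a * t ^ q) \<le> K1"
    using power_times_exp_bounded[OF assms] by blast
  obtain K2 where K2: "K2 \<ge> 0" "\<And>t::real. \<bar>t\<bar> ^ (n + 2) * exp (- a * t ^ q) \<le> K2"
    using power_times_exp_bounded[OF assms] by blast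
  show thesis
  proof (rule that[of "K1 + K2"])
    fix t :: real
    have "(\<bar>t\<bar> ^ n * exp (- a * t ^ q)) * (1 + t\<^sup>2) \<le> K1 + K2"
      using add_mono[OF K1(2)[of t] K2(2)[of t]]
      unfolding power_add power2_abs by (simp add: algebra_simps)
    then show "\<bar>t\<bar> ^ n * exp (- a * t ^ q) \<le> (K1 + K2) / (1 + t\<^sup>2)"
      by (simp add: pos_le_divide_eq add_pos_nonneg)
  qed (use K1 K2 in simp)
qed

lemma abs_exp_minus_1_le: "\<bar>exp E - 1\<bar> \<le> \<bar>E\<bar> * exp \<bar>E\<bar>" for E :: real
proof (cases "E \<ge> 0")
  case True
  have "1 - E \<le> exp (- E)" using exp_ge_add_one_self[of "- E"] by simp
  then have "(1 - E) * exp E \<le> exp (- E) * exp E" by (intro mult_right_mono) auto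
  then show ?thesis using True by (simp add: exp_minus algebra_simps)
next
  case False
  have "1 - exp E \<le> - E" using exp_ge_add_one_self[of E] by linarith
  also have "- E * 1 \<le> \<bar>E\<bar> * exp \<bar>E\<bar>" using False by (intro mult_mono) auto
  finally show ?thesis using False by simp
qed

text \<open>The two bounds on \<open>E\<close> have different tasks in
  \<open>\<bar>E\<bar> * exp \<bar>E\<bar>\<close>. The first supplies the small factor
  \<open>\<theta>\<close>; the second lets \<open>exp \<bar>E\<bar>\<close> use up only half of the
  decay, and the other half absorbs the polynomial in \<open>t\<close>.\<close>

lemma exp_perturbation_envelope:
  fixes a M L B D :: real
  assumes "a > 0" "even q" "q \<ge> 2"
  obtains K where "K \<ge> 0" "\<And>t \<theta> E. \<lbrakk>\<theta> \<ge> 0; \<bar>E\<bar> \<le> \<theta> * (M * \<bar>t\<bar> ^ Suc q + L * \<bar>t\<bar> + B);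
      \<bar>E\<bar> \<le> a / 2 * t ^ q + D\<rbrakk>
    \<Longrightarrow> \<bar>exp (- a * t ^ q + E) - exp (- a * t ^ q)\<bar> \<le> K * \<theta> / (1 + t\<^sup>2)"
proof -
  have a2: "a / 2 > 0" using assms by simp
  obtain K1 where K1: "K1 \<ge> 0" "\<And>t::real. \<bar>t\<bar> ^ Suc q * exp (- (a / 2) * t ^ q) \<le> K1 / (1 + t\<^sup>2)"
    using power_exp_envelope[OF a2 assms(2,3)] by blast
  obtain K2 where K2: "K2 \<ge> 0" "\<And>t::real. \<bar>t\<bar> ^ 1 * exp (- (a / 2) * t ^ q) \<le> K2 / (1 + t\<^sup>2)"
    using power_exp_envelope[OF a2 assms(2,3)] by blast
  obtain K3 where K3: "K3 \<ge> 0" "\<And>t::real. \<bar>t\<bar> ^ 0 * exp (- (a / 2) * t ^ q) \<le> K3 / (1 + t\<^sup>2)"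
    using power_exp_envelope[OF a2 assms(2,3)] by blast
  show thesis
  proof (rule that[of "exp D * (\<bar>M\<bar> * K1 + \<bar>L\<bar> * K2 + \<bar>B\<bar> * K3)"])
    fix t \<theta> E :: real
    assume \<theta>: "\<theta> \<ge> 0" and E: "\<bar>E\<bar> \<le> \<theta> * (M * \<bar>t\<bar> ^ Suc q + L * \<bar>t\<bar> + B)"
      "\<bar>E\<bar> \<le> a / 2 * t ^ q + D"
    let ?g = "exp (- (a / 2) * t ^ q)"
    have "M * \<bar>t\<bar> ^ Suc q \<le> \<bar>M\<bar> * \<bar>t\<bar> ^ Suc q" "L * \<bar>t\<bar> \<le> \<bar>L\<bar> * \<bar>t\<bar>"
      by (intro mult_right_mono; simp)+
    then have "M * \<bar>t\<bar> ^ Suc q + L * \<bar>t\<bar> + B \<le> \<bar>M\<bar> * \<bar>t\<bar> ^ Suc q + \<bar>L\<bar> * \<bar>t\<bar> + \<bar>B\<bar>"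
      by linarith
    then have E': "\<bar>E\<bar> \<le> \<theta> * (\<bar>M\<bar> * \<bar>t\<bar> ^ Suc q + \<bar>L\<bar> * \<bar>t\<bar> + \<bar>B\<bar>)"
      using E(1) \<theta> by (meson mult_left_mono order_trans)
    have "exp (- a * t ^ q + E) - exp (- a * t ^ q) = exp (- a * t ^ q) * (exp E - 1)"
      by (simp only: exp_add right_diff_distrib mult_1_right)
    then have "\<bar>exp (- a * t ^ q + E) - exp (- a * t ^ q)\<bar> = exp (- a * t ^ q) * \<bar>exp E - 1\<bar>"
      by (simp add: abs_mult)
    also have "\<dots> \<le> exp (- a * t ^ q) * (\<bar>E\<bar> * exp (a / 2 * t ^ q + D))"
      using E(2) by (intro mult_left_mono order_trans[OF abs_exp_minus_1_le]) auto
    also have "\<dots> = \<bar>E\<bar> * (exp D * ?g)"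
      by (simp add: exp_add[symmetric] field_simps)
    also have "\<dots> \<le> (\<theta> * (\<bar>M\<bar> * \<bar>t\<bar> ^ Suc q + \<bar>L\<bar> * \<bar>t\<bar> + \<bar>B\<bar>)) * (exp D * ?g)"
      using E' by (intro mult_right_mono) auto
    also have "\<dots> = \<theta> * exp D * (\<bar>M\<bar> * (\<bar>t\<bar> ^ Suc q * ?g) + \<bar>L\<bar> * (\<bar>t\<bar> ^ 1 * ?g) + \<bar>B\<bar> * (\<bar>t\<bar> ^ 0 * ?g))"
      by (simp add: algebra_simps)
    also have "\<dots> \<le> \<theta> * exp D * (\<bar>M\<bar> * (K1 / (1 + t\<^sup>2)) + \<bar>L\<bar> * (K2 / (1 + t\<^sup>2)) + \<bar>B\<bar> * (K3 / (1 + t\<^sup>2)))"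
      using \<theta> by (intro mult_left_mono add_mono K1(2) K2(2) K3(2)) auto
    also have "\<dots> = exp D * (\<bar>M\<bar> * K1 + \<bar>L\<bar> * K2 + \<bar>B\<bar> * K3) * \<theta> / (1 + t\<^sup>2)"
      by (simp add: add_divide_distrib algebra_simps)
    finally show "\<bar>exp (- a * t ^ q + E) - exp (- a * t ^ q)\<bar>
        \<le> exp D * (\<bar>M\<bar> * K1 + \<bar>L\<bar> * K2 + \<bar>B\<bar> * K3) * \<theta> / (1 + t\<^sup>2)" .
  qed (use K1 K2 K3 in auto)
qed

text \<open>The factors in front do not depend on \<open>j\<close>, so they cancel in every
  probability. They are chosen to make the weights near \<open>m\<close> of order 1.\<close>

definition local_weight :: "real \<Rightarrow> real \<Rightarrow> nat \<Rightarrow> real \<Rightarrow> nat \<Rightarrow> nat \<Rightarrow> real" where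
  "local_weight \<beta> h p m N j =
     sqrt (real N) / 2 ^ N * exp (- real N * Hfun \<beta> h p m) * lattice_weight \<beta> h p N j"

lemma local_weight_eq:
  "local_weight \<beta> h p m N j = sqrt (real N) * (real (N choose j) / 2 ^ N)
     * exp (real N * Ifun (mag N j)) * exp (real N * (Hfun \<beta> h p (mag N j) - Hfun \<beta> h p m))"
proof -
  have "real N * (\<beta> * mag N j ^ p + h * mag N j)
      = real N * Ifun (mag N j) + real N * Hfun \<beta> h p (mag N j)"
    by (simp add: Hfun_def algebra_simps)
  then show ?thesis
    by (simp add: local_weight_def lattice_weight_def exp_add right_diff_distrib exp_diff exp_minus field_simps)
qed

lemma local_weight_le:
  assumes "N \<ge> 1" "j \<le> N"
  shows "local_weight \<beta> h p m N j \<le> sqrt (real N) * exp (real N * (Hfun \<beta> h p (mag N j) - Hfun \<beta> h p m))"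
proof -
  have "real (N choose j) / 2 ^ N * exp (real N * Ifun (mag N j)) \<le> 1"
    using binomial_entropy_bound[OF assms] by (simp add: exp_minus field_simps)
  then have "sqrt (real N) * (real (N choose j) / 2 ^ N * exp (real N * Ifun (mag N j)))
      * exp (real N * (Hfun \<beta> h p (mag N j) - Hfun \<beta> h p m))
      \<le> sqrt (real N) * 1 * exp (real N * (Hfun \<beta> h p (mag N j) - Hfun \<beta> h p m))"
    by (intro mult_right_mono mult_left_mono) auto
  then show ?thesis by (simp add: local_weight_eq mult_ac)
qed

lemma local_weight_near:
  fixes a m :: real
  assumes m: "-1 < m" "m < 1" and q: "even q" "q \<ge> 2" and a: "a > 0"
    and expansion: "\<And>x. \<bar>x - m\<bar> \<le> (1 - \<bar>m\<bar>) / 2 \<Longrightarrow>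
      \<bar>Hfun \<beta> h p x - Hfun \<beta> h p m + a * (x - m) ^ q\<bar> \<le> M * \<bar>x - m\<bar> ^ Suc q"
  obtains \<kappa> \<delta> K where "\<kappa> > 0" "\<delta> > 0" "K \<ge> 0"
    "\<And>N j T. \<lbrakk>N \<ge> 1; j \<le> N; T \<ge> 1; T ^ q = real N; \<bar>mag N j - m\<bar> \<le> \<delta>\<rbrakk> \<Longrightarrow>
      \<bar>\<kappa> * local_weight \<beta> h p m N j - exp (- a * (T * (mag N j - m)) ^ q)\<bar>
        \<le> K * (1 / T) / (1 + (T * (mag N j - m))\<^sup>2)"
proof -
  obtain \<kappa> L B where \<kappa>: "\<kappa> > 0" and LB: "L \<ge> 0" "B \<ge> 0"
    and stirling: "\<And>N j. \<lbrakk>N \<ge> 1; j \<le> N; \<bar>mag N j - m\<bar> \<le> (1 - \<bar>m\<bar>) / 2\<rbrakk> \<Longrightarrow>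
      \<bar>ln (\<kappa> * sqrt (real N) * (real (N choose j) / 2 ^ N)) + real N * Ifun (mag N j)\<bar>
        \<le> L * \<bar>mag N j - m\<bar> + B / real N"
    using binomial_local_asymptotics[OF m] by metis
  obtain K where K: "K \<ge> 0" "\<And>t \<theta> E. \<lbrakk>\<theta> \<ge> 0; \<bar>E\<bar> \<le> \<theta> * (\<bar>M\<bar> * \<bar>t\<bar> ^ Suc q + L * \<bar>t\<bar> + B);
      \<bar>E\<bar> \<le> a / 2 * t ^ q + (L + B)\<rbrakk>
    \<Longrightarrow> \<bar>exp (- a * t ^ q + E) - exp (- a * t ^ q)\<bar> \<le> K * \<theta> / (1 + t\<^sup>2)"
    using exp_perturbation_envelope[OF a q] by metis
  \<comment> \<open>The second entry keeps the Taylor remainder below \<open>a / 2 * t ^ q\<close>,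
    half of the leading term; adding 1 to \<open>\<bar>M\<bar>\<close> covers
    \<open>M = 0\<close>.\<close>
  define \<delta> where "\<delta> = min ((1 - \<bar>m\<bar>) / 2) (a / (2 * (\<bar>M\<bar> + 1)))"
  have \<delta>_le: "\<delta> \<le> (1 - \<bar>m\<bar>) / 2" unfolding \<delta>_def by (rule min.cobounded1)
  also have "(1 - \<bar>m\<bar>) / 2 \<le> 1" by simp
  finally have "\<delta> \<le> 1" .
  moreover have "\<delta> > 0" using m a by (auto simp: \<delta>_def)
  ultimately have \<delta>: "\<delta> > 0" "\<delta> \<le> 1" "\<delta> \<le> (1 - \<bar>m\<bar>) / 2"
    using \<delta>_le by blast+
  have M\<delta>: "\<bar>M\<bar> * \<delta> \<le> a / 2"
  proof -
    have "\<bar>M\<bar> * \<delta> \<le> (\<bar>M\<bar> + 1) * (a / (2 * (\<bar>M\<bar> + 1)))"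
      using \<delta> by (intro mult_mono) (auto simp: \<delta>_def)
    also have "\<dots> = a / 2"
    proof -
      have "y * (a / (2 * y)) = a / 2" if "y > 0" for y using that by simp
      moreover have "\<bar>M\<bar> + 1 > 0" by (simp add: add_nonneg_pos)
      ultimately show ?thesis by blast
    qed
    finally show ?thesis .
  qed
  show thesis
  proof (rule that[OF \<kappa> \<delta>(1) K(1)])
    fix N j :: nat and T :: real
    assume N: "N \<ge> 1" and j: "j \<le> N" and T: "T \<ge> 1" "T ^ q = real N" and near: "\<bar>mag N j - m\<bar> \<le> \<delta>"
    define x where "x = mag N j"
    define u where "u = \<bar>x - m\<bar>"
    define t where "t = T * (x - m)"
    have tT: "\<bar>t\<bar> = T * u" using T by (simp add: t_def u_def abs_mult)
    have u: "0 \<le> u" "u \<le> \<delta>" "u \<le> 1" using near \<delta> by (auto simp: u_def x_def)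
    have N0: "real N > 0" using N by simp
    have T_le: "T \<le> real N"
      using self_le_power[of T q] T q by simp
    define \<rho> where "\<rho> = ln (\<kappa> * sqrt (real N) * (real (N choose j) / 2 ^ N)) + real N * Ifun x"
    define E1 where "E1 = real N * (Hfun \<beta> h p x - Hfun \<beta> h p m + a * (x - m) ^ q)"
    have \<rho>: "\<bar>\<rho>\<bar> \<le> L * u + B / real N"
      using stirling[OF N j] near \<delta> by (simp add: \<rho>_def x_def u_def)
    have E1: "\<bar>E1\<bar> \<le> real N * (\<bar>M\<bar> * u ^ Suc q)"
    proof -
      have "M * u ^ Suc q \<le> \<bar>M\<bar> * u ^ Suc q" using u by (intro mult_right_mono) auto
      then have "\<bar>Hfun \<beta> h p x - Hfun \<beta> h p m + a * (x - m) ^ q\<bar> \<le> \<bar>M\<bar> * u ^ Suc q"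
        using expansion[of x] near \<delta> by (simp add: x_def u_def)
      then show ?thesis
        unfolding E1_def abs_mult using N0 by (simp add: mult_left_mono)
    qed
    have tq: "t ^ q = real N * (x - m) ^ q" by (simp add: t_def power_mult_distrib T)
    have pos: "\<kappa> * sqrt (real N) * (real (N choose j) / 2 ^ N) > 0"
      using \<kappa> N0 j by simp
    have "\<kappa> * local_weight \<beta> h p m N j = exp \<rho> * exp (real N * (Hfun \<beta> h p x - Hfun \<beta> h p m))"
      unfolding \<rho>_def exp_add exp_ln[OF pos] local_weight_eq x_def by (simp add: mult_ac)
    also have "\<dots> = exp (- a * t ^ q + (E1 + \<rho>))"
      by (simp add: exp_add[symmetric] E1_def tq algebra_simps)
    finally have w: "\<kappa> * local_weight \<beta> h p m N j = exp (- a * t ^ q + (E1 + \<rho>))" .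
    have "\<bar>exp (- a * t ^ q + (E1 + \<rho>)) - exp (- a * t ^ q)\<bar> \<le> K * (1 / T) / (1 + t\<^sup>2)"
    proof (rule K(2))
      have "real N * (\<bar>M\<bar> * u ^ Suc q) = 1 / T * (\<bar>M\<bar> * \<bar>t\<bar> ^ Suc q)"
        using T by (simp add: tT power_mult_distrib flip: T(2))
      moreover have "L * u = 1 / T * (L * \<bar>t\<bar>)" using T by (simp add: tT)
      moreover have "B / real N \<le> 1 / T * B"
        using T_le T LB by (simp add: frac_le)
      ultimately show "\<bar>E1 + \<rho>\<bar> \<le> 1 / T * (\<bar>M\<bar> * \<bar>t\<bar> ^ Suc q + L * \<bar>t\<bar> + B)"
        using E1 \<rho> abs_triangle_ineq[of E1 \<rho>] unfolding distrib_left by linarith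
      have "real N * (\<bar>M\<bar> * u ^ Suc q) = (\<bar>M\<bar> * u) * (real N * u ^ q)" by simp
      also have "\<dots> \<le> (a / 2) * (real N * u ^ q)"
      proof (rule mult_right_mono)
        have "\<bar>M\<bar> * u \<le> \<bar>M\<bar> * \<delta>" using u by (intro mult_left_mono) auto
        then show "\<bar>M\<bar> * u \<le> a / 2" using M\<delta> by linarith
      qed (use u in auto)
      also have "real N * u ^ q = t ^ q" using q by (simp add: tq u_def power_even_abs)
      finally have "\<bar>E1\<bar> \<le> a / 2 * t ^ q" using E1 by linarith
      moreover have "L * u \<le> L" using LB u by (simp add: mult_left_le)
      moreover have "B * 1 \<le> B * real N" using LB N by (intro mult_left_mono) auto
      then have "B / real N \<le> B" using N0 by (simp add: divide_le_eq)
      ultimately show "\<bar>E1 + \<rho>\<bar> \<le> a / 2 * t ^ q + (L + B)"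
        using \<rho> abs_triangle_ineq[of E1 \<rho>] by linarith
    qed (use T in simp)
    then show "\<bar>\<kappa> * local_weight \<beta> h p m N j - exp (- a * (T * (mag N j - m)) ^ q)\<bar>
        \<le> K * (1 / T) / (1 + (T * (mag N j - m))\<^sup>2)"
      unfolding w by (simp add: t_def x_def)
  qed
qed

text \<open>Far from \<open>m\<close> the weight and the density are not compared with each other;
  each separately lies below the envelope. The density spends one power of
  \<open>\<bar>t\<bar> \<ge> \<delta> * T\<close> to gain \<open>1 / T\<close>, and the weight is
  exponentially small in \<open>n\<close>.\<close>

lemma tail_envelope:
  fixes a \<eta> \<delta> :: real
  assumes q: "even q" "q \<ge> 2" and "a > 0" "\<eta> > 0" "\<delta> > 0"
  obtains K where "K \<ge> 0"
    "\<And>T t n. \<lbrakk>T \<ge> 1; T ^ q = n; \<delta> * T \<le> \<bar>t\<bar>; \<bar>t\<bar> \<le> 2 * T\<rbrakk> \<Longrightarrow>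
       sqrt n * exp (- \<eta> * n) \<le> K * (1 / T) / (1 + t\<^sup>2) \<and> exp (- a * t ^ q) \<le> K * (1 / T) / (1 + t\<^sup>2)"
proof -
  obtain K1 where K1: "K1 \<ge> 0" "\<And>t::real. \<bar>t\<bar> ^ 1 * exp (- a * t ^ q) \<le> K1 / (1 + t\<^sup>2)"
    using power_exp_envelope[OF \<open>a > 0\<close> q] by blast
  define K2 where "K2 = 5 * (fact 3 / \<eta> ^ 3)"
  show thesis
  proof (rule that[of "K1 / \<delta> + K2"])
    fix T t n :: real
    assume T: "T \<ge> 1" "T ^ q = n" and t: "\<delta> * T \<le> \<bar>t\<bar>" "\<bar>t\<bar> \<le> 2 * T"
    have p: "1 + t\<^sup>2 > 0" by (simp add: add_pos_nonneg)
    have "T\<^sup>2 \<le> T ^ q" using T q by (intro power_increasing) auto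
    then have T2: "T\<^sup>2 \<le> n" using T by simp
    have "T \<le> T\<^sup>2" using self_le_power[of T 2] T by simp
    then have n: "T \<le> n" "1 \<le> n" using T2 T by linarith+
    have "t\<^sup>2 \<le> (2 * T)\<^sup>2" using t(2) T by (metis abs_le_square_iff abs_of_nonneg abs_ge_zero order_trans)
    then have t2: "1 + t\<^sup>2 \<le> 5 * n" using T2 n by (simp add: power_mult_distrib)
    have "(\<eta> * n) ^ 3 * exp (- (\<eta> * n)) \<le> fact 3"
      using power_le_fact_exp[of "\<eta> * n" 3] n \<open>\<eta> > 0\<close> by (simp add: exp_minus field_simps)
    then have e: "n ^ 3 * exp (- \<eta> * n) \<le> fact 3 / \<eta> ^ 3"
      using \<open>\<eta> > 0\<close> by (simp add: power_mult_distrib field_simps)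
    have "sqrt n \<le> n" using n by (simp add: real_sqrt_le_iff sqrt_le_D real_le_lsqrt power2_eq_square)
    \<comment> \<open>With \<open>sqrt n \<le> n\<close>, \<open>T \<le> n\<close> and
      \<open>1 + t^2 \<le> 5 * n\<close>, three powers of \<open>n\<close> are enough; this is the
      origin of \<open>fact 3 / \<eta> ^ 3\<close>.\<close>
    have "sqrt n * exp (- \<eta> * n) * (T * (1 + t\<^sup>2)) \<le> n * exp (- \<eta> * n) * (n * (5 * n))"
      using n t2 p \<open>sqrt n \<le> n\<close> T by (intro mult_mono) auto
    also have "\<dots> = 5 * (n ^ 3 * exp (- \<eta> * n))" by (simp add: power3_eq_cube)
    also have "\<dots> \<le> K2" using e by (simp add: K2_def)
    finally have 1: "sqrt n * exp (- \<eta> * n) \<le> K2 * (1 / T) / (1 + t\<^sup>2)"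
      using T p by (simp add: pos_le_divide_eq mult_ac)
    have "\<delta> * T * exp (- a * t ^ q) \<le> \<bar>t\<bar> ^ 1 * exp (- a * t ^ q)"
      using t by (intro mult_right_mono) auto
    also have "\<dots> \<le> K1 / (1 + t\<^sup>2)" by (rule K1(2))
    finally have 2: "exp (- a * t ^ q) \<le> K1 / \<delta> * (1 / T) / (1 + t\<^sup>2)"
      using T p \<open>\<delta> > 0\<close> by (simp add: pos_le_divide_eq mult_ac)
    have "0 \<le> K1 / \<delta> * (1 / T) / (1 + t\<^sup>2)" "0 \<le> K2 * (1 / T) / (1 + t\<^sup>2)"
      using K1 \<open>\<delta> > 0\<close> \<open>\<eta> > 0\<close> T p by (auto simp: K2_def)
    then show "sqrt n * exp (- \<eta> * n) \<le> (K1 / \<delta> + K2) * (1 / T) / (1 + t\<^sup>2) \<and>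
        exp (- a * t ^ q) \<le> (K1 / \<delta> + K2) * (1 / T) / (1 + t\<^sup>2)"
      using 1 2 by (simp add: distrib_right add_divide_distrib)
  qed (use K1 assms in \<open>auto simp: K2_def\<close>)
qed

lemma envelope_density:
  fixes a c :: real
  assumes "a > 0" "c > 0" "even q" "q \<ge> 2"
  obtains K f' where
    "\<And>s. ((\<lambda>s. c * exp (- a * s ^ q)) has_real_derivative f' s) (at s)"
    "\<And>s. c * exp (- a * s ^ q) \<le> K / (1 + s\<^sup>2)" "\<And>s. \<bar>f' s\<bar> \<le> K / (1 + s\<^sup>2)"
proof -
  obtain K0 where K0: "K0 \<ge> 0" "\<And>t::real. \<bar>t\<bar> ^ 0 * exp (- a * t ^ q) \<le> K0 / (1 + t\<^sup>2)"
    using power_exp_envelope[OF assms(1,3,4)] by blast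
  obtain K1 where K1: "K1 \<ge> 0" "\<And>t::real. \<bar>t\<bar> ^ (q - 1) * exp (- a * t ^ q) \<le> K1 / (1 + t\<^sup>2)"
    using power_exp_envelope[OF assms(1,3,4)] by blast
  define f' where "f' = (\<lambda>s::real. c * (- a * (real q * s ^ (q - 1))) * exp (- a * s ^ q))"
  have p: "1 + s\<^sup>2 > 0" for s :: real by (simp add: add_pos_nonneg)
  show thesis
  proof (rule that[of f' "c * K0 + c * a * real q * K1"])
    show "((\<lambda>s. c * exp (- a * s ^ q)) has_real_derivative f' s) (at s)" for s
      unfolding f'_def by (auto intro!: derivative_eq_intros)
    have A: "c * exp (- a * s ^ q) \<le> c * K0 / (1 + s\<^sup>2)" for s
      using mult_left_mono[OF K0(2)[of s], of c] assms by simp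
    have B: "\<bar>f' s\<bar> \<le> c * a * real q * K1 / (1 + s\<^sup>2)" for s
      using mult_left_mono[OF K1(2)[of s], of "c * a * real q"] assms
      by (simp add: f'_def abs_mult power_abs mult_ac)
    have "0 \<le> c * K0 / (1 + s\<^sup>2)" "0 \<le> c * a * real q * K1 / (1 + s\<^sup>2)" for s
      using p[of s] assms K0 K1 by auto
    then show "c * exp (- a * s ^ q) \<le> (c * K0 + c * a * real q * K1) / (1 + s\<^sup>2)"
      "\<bar>f' s\<bar> \<le> (c * K0 + c * a * real q * K1) / (1 + s\<^sup>2)" for s
      using A[of s] B[of s] unfolding add_divide_distrib by (meson add_increasing add_increasing2)+
  qed
qed

text \<open>The common core of all three cases. The hypothesis \<open>gap\<close> says that within
  \<open>A\<close> only \<open>m\<close> competes for the maximum; \<open>F\<close> is any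
  distribution function whose density is proportional to \<open>exp (- a * s ^ q)\<close>.\<close>

lemma cw_local_limit:
  fixes a c m r :: real and F :: "real \<Rightarrow> real"
  assumes m: "-1 < m" "m < 1" and q: "even q" "q \<ge> 2" and a: "a > 0" and c: "c > 0"
    and expansion: "\<And>x. \<bar>x - m\<bar> \<le> (1 - \<bar>m\<bar>) / 2 \<Longrightarrow>
      \<bar>Hfun \<beta> h p x - Hfun \<beta> h p m + a * (x - m) ^ q\<bar> \<le> M * \<bar>x - m\<bar> ^ Suc q"
    and nbhd: "r > 0" "\<And>x. \<bar>x - m\<bar> < r \<Longrightarrow> x \<in> A"
    and gap: "\<And>\<delta>. \<delta> > 0 \<Longrightarrow> \<exists>\<eta>>0. \<forall>x\<in>A \<inter> {-1..1}. \<delta> \<le> \<bar>x - m\<bar> \<longrightarrow>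
      Hfun \<beta> h p x \<le> Hfun \<beta> h p m - \<eta>"
    and F: "\<And>s. (F has_real_derivative c * exp (- a * s ^ q)) (at s)"
      "(F \<longlongrightarrow> 0) at_bot" "(F \<longlongrightarrow> 1) at_top"
  shows "\<exists>C. \<forall>\<^sub>F N in sequentially. \<forall>y.
    \<bar>cw_cond_prob N \<beta> h p (\<lambda>X. real N powr (1 / real q) * (S_N N X / real N - m) \<le> y)
        (\<lambda>X. S_N N X / real N \<in> A) - F y\<bar> \<le> C / real N powr (1 / real q)"
proof -
  obtain \<kappa> \<delta>0 K where \<kappa>: "\<kappa> > 0" and \<delta>0: "\<delta>0 > 0" and K: "K \<ge> 0"
    and near: "\<And>N j T. \<lbrakk>N \<ge> 1; j \<le> N; T \<ge> 1; T ^ q = real N; \<bar>mag N j - m\<bar> \<le> \<delta>0\<rbrakk> \<Longrightarrow>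
      \<bar>\<kappa> * local_weight \<beta> h p m N j - exp (- a * (T * (mag N j - m)) ^ q)\<bar>
        \<le> K * (1 / T) / (1 + (T * (mag N j - m))\<^sup>2)"
    using local_weight_near[OF m q a expansion] by metis
  define \<delta> where "\<delta> = min \<delta>0 (r / 2)"
  have \<delta>: "\<delta> > 0" "\<delta> \<le> \<delta>0" "\<delta> < r" using \<delta>0 nbhd by (auto simp: \<delta>_def)
  obtain \<eta> where \<eta>: "\<eta> > 0" "\<And>x. x \<in> A \<Longrightarrow> x \<in> {-1..1} \<Longrightarrow> \<delta> \<le> \<bar>x - m\<bar> \<Longrightarrow>
      Hfun \<beta> h p x \<le> Hfun \<beta> h p m - \<eta>"
    using gap[OF \<delta>(1)] by blast
  obtain K' where K': "K' \<ge> 0"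
    "\<And>T t n. \<lbrakk>T \<ge> 1; T ^ q = n; \<delta> * T \<le> \<bar>t\<bar>; \<bar>t\<bar> \<le> 2 * T\<rbrakk> \<Longrightarrow>
       sqrt n * exp (- \<eta> * n) \<le> K' * (1 / T) / (1 + t\<^sup>2) \<and> exp (- a * t ^ q) \<le> K' * (1 / T) / (1 + t\<^sup>2)"
    using tail_envelope[OF q a \<eta>(1) \<delta>(1)] by metis
  \<comment> \<open>The summands bound, in order, the difference close to \<open>m\<close>, the
    weight far from \<open>m\<close>, and the limit density far from \<open>m\<close>.\<close>
  define B where "B = c * (K + \<kappa> * K' + K')"
  define f where "f = (\<lambda>s::real. c * exp (- a * s ^ q))"
  obtain Kf f' where f': "\<And>s. (f has_real_derivative f' s) (at s)"
    "\<And>s. f s \<le> Kf / (1 + s\<^sup>2)" "\<And>s. \<bar>f' s\<bar> \<le> Kf / (1 + s\<^sup>2)"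
    using envelope_density[OF a c q] unfolding f_def by metis
  \<comment> \<open>The distance from \<open>m\<close> to the ends of \<open>[-1, 1]\<close>. The
    rescaled lattice runs from \<open>- T * (1 + m)\<close> to \<open>T * (1 - m)\<close>, so with
    \<open>\<epsilon> = 1 / T\<close> it covers \<open>- c0 / \<epsilon>\<close> to
    \<open>c0 / \<epsilon>\<close>.\<close>
  define c0 where "c0 = min (1 + m) (1 - m)"
  have c0: "c0 > 0" using m by (simp add: c0_def)
  have F': "\<And>s. (F has_real_derivative f s) (at s)" using F(1) by (simp add: f_def)
  have f0: "0 \<le> f s" for s using c by (simp add: f_def)
  obtain \<epsilon>0 C where \<epsilon>0: "\<epsilon>0 > 0" and approx:
    "\<forall>t0 d \<epsilon> w N y.
    0 < d \<longrightarrow> d \<le> 2 * \<epsilon> \<longrightarrow> \<epsilon> \<le> \<epsilon>0 \<longrightarrow> t0 \<le> - c0 / \<epsilon> \<longrightarrow> t0 + real N * d \<ge> c0 / \<epsilon> \<longrightarrow>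
    (\<forall>j\<le>N. \<bar>w j - f (t0 + real j * d)\<bar> \<le> B * \<epsilon> / (1 + (t0 + real j * d)\<^sup>2)) \<longrightarrow>
     \<bar>(\<Sum>j | j \<le> N \<and> t0 + real j * d \<le> y. w j) / (\<Sum>j\<le>N. w j) - F y\<bar> \<le> C * \<epsilon>"
    using lattice_cdf_approx[OF F' f'(1) f0 f'(2,3) F(2,3) c0, of B] by (elim exE conjE)
  have main: "\<bar>cw_cond_prob N \<beta> h p (\<lambda>X. real N powr (1 / real q) * (S_N N X / real N - m) \<le> y)
      (\<lambda>X. S_N N X / real N \<in> A) - F y\<bar> \<le> C / real N powr (1 / real q)"
    if N: "N \<ge> 1" "real N \<ge> (1 / \<epsilon>0) ^ q" for N y
  proof -
    define T where "T = real N powr (1 / real q)"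
    have T: "T \<ge> 1" "T ^ q = real N"
      using N q by (auto simp: T_def ge_one_powr_ge_zero powr_realpow[symmetric] powr_powr)
    have T\<epsilon>: "1 / T \<le> \<epsilon>0"
    proof -
      have "1 / \<epsilon>0 \<le> T"
        by (rule power_mono_iff[THEN iffD1, of _ _ q]) (use N(2) T q \<epsilon>0 in auto)
      then show ?thesis using \<epsilon>0 T by (simp add: field_simps)
    qed
    have "T\<^sup>2 \<le> T ^ q" using T q by (intro power_increasing) auto
    then have T2: "T * T \<le> real N" using T by (simp add: power2_eq_square)
    define d t0 where "d = 2 * T / real N" and "t0 = T * (- 1 - m)"
    have lat: "t0 + real j * d = T * (mag N j - m)" for j
      using N by (simp add: t0_def d_def mag_def field_simps)
    have magN: "mag N N = 1" using N by (simp add: mag_def)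
    \<comment> \<open>Setting the weight to zero off \<open>A\<close> keeps the full lattice and
      turns conditioning into division by the total sum.\<close>
    define w where "w = (\<lambda>j. if mag N j \<in> A then c * \<kappa> * local_weight \<beta> h p m N j else 0)"
    have bound: "\<bar>w j - f (t0 + real j * d)\<bar> \<le> B * (1 / T) / (1 + (t0 + real j * d)\<^sup>2)" if j: "j \<le> N" for j
    proof -
      define x where "x = mag N j"
      define t where "t = T * (x - m)"
      define v where "v = (1 / T) / (1 + t\<^sup>2)"
      have v: "v \<ge> 0" using T by (simp add: v_def)
      have x: "-1 \<le> x" "x \<le> 1" using N j by (simp_all add: x_def mag_def field_simps)
      have "\<bar>w j - f t\<bar> \<le> B * v"
      proof (cases "\<bar>x - m\<bar> < \<delta>")
        case True
        then have "x \<in> A" using nbhd(2) \<delta> by simp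
        then have "w j - f t = c * (\<kappa> * local_weight \<beta> h p m N j - exp (- a * t ^ q))"
          by (simp add: w_def f_def x_def right_diff_distrib mult_ac)
        then have "\<bar>w j - f t\<bar> = c * \<bar>\<kappa> * local_weight \<beta> h p m N j - exp (- a * t ^ q)\<bar>"
          using c by (simp add: abs_mult)
        also have "\<dots> \<le> c * (K * v)"
          using near[OF N(1) j T] True \<delta> c by (intro mult_left_mono) (auto simp: t_def x_def v_def)
        also have "\<dots> \<le> B * v"
          using c v \<kappa> K' unfolding B_def mult.assoc by (intro mult_left_mono mult_right_mono) auto
        finally show ?thesis .
      next
        case False
        have tT: "\<bar>t\<bar> = T * \<bar>x - m\<bar>" using T by (simp add: t_def abs_mult)
        have "\<delta> * T \<le> \<bar>t\<bar>" unfolding tT using False T by (simp add: mult.commute mult_left_mono)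
        moreover have "\<bar>t\<bar> \<le> 2 * T" unfolding tT using x m T by (simp add: mult.commute mult_left_mono)
        ultimately have tail: "sqrt (real N) * exp (- \<eta> * real N) \<le> K' * v" "exp (- a * t ^ q) \<le> K' * v"
          using K'(2)[OF T] by (auto simp: v_def)
        have w0: "0 \<le> w j" using c \<kappa> by (simp add: w_def local_weight_def lattice_weight_def)
        have "w j \<le> c * \<kappa> * (K' * v)"
        proof (cases "x \<in> A")
          case True
          have "local_weight \<beta> h p m N j \<le> sqrt (real N) * exp (real N * (Hfun \<beta> h p x - Hfun \<beta> h p m))"
            unfolding x_def by (rule local_weight_le[OF N(1) j])
          also have "\<dots> \<le> sqrt (real N) * exp (- \<eta> * real N)"
          proof -
            have "Hfun \<beta> h p x - Hfun \<beta> h p m \<le> - \<eta>"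
              using \<eta>(2)[OF True] x False by simp
            then have "real N * (Hfun \<beta> h p x - Hfun \<beta> h p m) \<le> real N * (- \<eta>)"
              by (intro mult_left_mono) auto
            then show ?thesis by (intro mult_left_mono) (auto simp: mult.commute)
          qed
          also have "\<dots> \<le> K' * v" by (rule tail)
          finally have "c * \<kappa> * local_weight \<beta> h p m N j \<le> c * \<kappa> * (K' * v)"
            using c \<kappa> by (intro mult_left_mono) auto
          then show ?thesis using True by (simp add: w_def x_def)
        next
          case False
          then show ?thesis using c \<kappa> K' v by (simp add: w_def x_def)
        qed
        moreover have "f t \<le> c * (K' * v)"
          unfolding f_def using tail c by (intro mult_left_mono) auto
        moreover have "0 \<le> c * (K * v)" using c K v by simp
        moreover have "B * v = c * (K * v) + c * \<kappa> * (K' * v) + c * (K' * v)"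
          by (simp add: B_def algebra_simps)
        ultimately show ?thesis using w0 f0[of t] by (simp add: abs_le_iff)
      qed
      then show ?thesis unfolding lat by (simp add: t_def x_def v_def)
    qed
    have "\<bar>(\<Sum>j | j \<le> N \<and> t0 + real j * d \<le> y. w j) / (\<Sum>j\<le>N. w j) - F y\<bar> \<le> C * (1 / T)"
    proof (rule approx[rule_format, OF _ _ T\<epsilon> _ _ bound])
      show "0 < d" using T N by (simp add: d_def)
      show "d \<le> 2 * (1 / T)" using T2 T N by (simp add: d_def field_simps)
      have "T * c0 \<le> T * (1 + m)" "T * c0 \<le> T * (1 - m)"
        using T by (intro mult_left_mono; simp add: c0_def)+
      then show "t0 \<le> - c0 / (1 / T)" "c0 / (1 / T) \<le> t0 + real N * d"
        unfolding lat magN by (simp_all add: t0_def algebra_simps)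
    qed
    moreover define G where "G = c * \<kappa> * (sqrt (real N) / 2 ^ N * exp (- real N * Hfun \<beta> h p m))"
    have G: "G \<noteq> 0" using c \<kappa> N by (simp add: G_def)
    have w_eq: "w j = (if mag N j \<in> A then G * lattice_weight \<beta> h p N j else 0)" for j
      by (simp add: w_def G_def local_weight_def)
    have "(\<Sum>j | j \<le> N \<and> t0 + real j * d \<le> y. w j)
        = G * (\<Sum>j | j \<le> N \<and> T * (mag N j - m) \<le> y \<and> mag N j \<in> A. lattice_weight \<beta> h p N j)"
      unfolding w_eq lat by (subst sum.inter_filter[symmetric]) (simp_all add: sum_distrib_left conj_ac)
    moreover have "(\<Sum>j\<le>N. w j) = G * (\<Sum>j | j \<le> N \<and> mag N j \<in> A. lattice_weight \<beta> h p N j)"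
      unfolding w_eq by (subst sum.inter_filter[symmetric]) (simp_all add: sum_distrib_left)
    ultimately have "\<bar>(\<Sum>j | j \<le> N \<and> T * (mag N j - m) \<le> y \<and> mag N j \<in> A. lattice_weight \<beta> h p N j)
        / (\<Sum>j | j \<le> N \<and> mag N j \<in> A. lattice_weight \<beta> h p N j) - F y\<bar> \<le> C / T"
      using G by simp
    then show ?thesis
      using cw_cond_prob_eq[OF N(1), where P = "\<lambda>s. T * (s / real N - m) \<le> y" and Q = "\<lambda>s. s / real N \<in> A"
          and \<beta> = \<beta> and h = h and p = p]
      by (simp add: mag_def T_def)
  qed
  have "\<forall>\<^sub>F N in sequentially. N \<ge> 1 \<and> real N \<ge> (1 / \<epsilon>0) ^ q"
    using eventually_ge_at_top[of 1] eventually_ge_at_top[of "nat \<lceil>(1 / \<epsilon>0) ^ q\<rceil>"]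
    by eventually_elim linarith
  then show ?thesis
    by (intro exI[of _ C]) (auto elim!: eventually_mono intro: main)
qed

lemma quadratic_maximum:
  assumes m: "-1 < m" "m < 1" "global_max \<beta> h p m"
  obtains M where "\<And>x. \<bar>x - m\<bar> \<le> (1 - \<bar>m\<bar>) / 2 \<Longrightarrow>
    \<bar>Hfun \<beta> h p x - Hfun \<beta> h p m + (- Hder 2 \<beta> h p m / 2) * (x - m) ^ 2\<bar> \<le> M * \<bar>x - m\<bar> ^ Suc 2"
proof -
  have "Hd \<beta> h p 1 m = 0"
    by (rule global_max_derivs(2)[OF m(1,2) _ m(3)]) auto
  then have zero: "Hd \<beta> h p k m = 0" if "1 \<le> k" "k < 2" for k
    using that by (cases "k = 1") auto
  obtain M where "\<And>x. \<bar>x - m\<bar> \<le> (1 - \<bar>m\<bar>) / 2 \<Longrightarrow>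
    \<bar>Hfun \<beta> h p x - Hfun \<beta> h p m - Hd \<beta> h p 2 m / fact 2 * (x - m) ^ 2\<bar> \<le> M * \<bar>x - m\<bar> ^ Suc 2"
    using Hfun_taylor[OF m(1,2) _ zero] by (metis one_le_numeral)
  then show thesis
    using Hder_eq_Hd[OF m(1,2)] by (intro that[of M]) simp
qed

section \<open>The limit theorems\<close>

text \<open>Compactness has to be applied to the closure: points of \<open>A\<close> could otherwise
  approach another maximizer outside \<open>A\<close>, and no uniform gap would exist.\<close>

lemma maximum_gap:
  assumes m: "global_max \<beta> h p m"
    and other: "\<And>m'. global_max \<beta> h p m' \<Longrightarrow> m' \<noteq> m \<Longrightarrow> m' \<notin> closure A"
    and "\<delta> > 0"
  shows "\<exists>\<eta>>0. \<forall>x\<in>A \<inter> {-1..1}. \<delta> \<le> \<bar>x - m\<bar> \<longrightarrow> Hfun \<beta> h p x \<le> Hfun \<beta> h p m - \<eta>"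
proof -
  have "closed {x. \<delta> \<le> \<bar>x - m\<bar>}"
    by (intro closed_Collect_le continuous_intros)
  then have cl: "closed (closure A \<inter> {x. \<delta> \<le> \<bar>x - m\<bar>})" by (intro closed_Int closed_closure)
  have lt: "Hfun \<beta> h p x < Hfun \<beta> h p m"
    if x: "x \<in> closure A \<inter> {x. \<delta> \<le> \<bar>x - m\<bar>}" "x \<in> {-1..1}" for x
  proof (rule ccontr)
    assume "\<not> Hfun \<beta> h p x < Hfun \<beta> h p m"
    then have "global_max \<beta> h p x"
      using m x(2) unfolding global_max_def by (auto intro: order_trans)
    moreover have "x \<noteq> m" using x \<open>\<delta> > 0\<close> by auto
    ultimately show False using other[of x] x by blast
  qed
  obtain \<eta> where "\<eta> > 0" "\<And>x. x \<in> closure A \<inter> {x. \<delta> \<le> \<bar>x - m\<bar>} \<Longrightarrow> x \<in> {-1..1} \<Longrightarrow>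
      Hfun \<beta> h p x \<le> Hfun \<beta> h p m - \<eta>"
    using Hfun_gap[OF cl lt] by metis
  then show ?thesis using closure_subset[of A] by (intro exI[of _ \<eta>]) auto
qed

lemma Phi_cdf:
  shows "(Phi has_real_derivative std_normal_density x) (at x)"
    and "(Phi \<longlongrightarrow> 0) at_bot" and "(Phi \<longlongrightarrow> 1) at_top"
proof -
  interpret prob_space "density lborel std_normal_density"
    by (rule prob_space_normal_density) simp
  have "(\<integral>\<^sup>+x. ennreal (std_normal_density x) \<partial>lborel) = 1"
    using emeasure_space_1 by (simp add: emeasure_density)
  moreover have "continuous_on UNIV std_normal_density"
    unfolding normal_density_def by (intro continuous_intros) auto
  ultimately show "(Phi has_real_derivative std_normal_density x) (at x)"
    "(Phi \<longlongrightarrow> 0) at_bot" "(Phi \<longlongrightarrow> 1) at_top"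
    unfolding Phi_def[abs_def] by (intro density_cdf; simp)+
qed

lemma F_special_cdf:
  assumes "H4 < 0"
  shows "(F_special H4 has_real_derivative
      2 / Gamma (1/4) * (- H4 / 24) powr (1/4) * exp (H4 / 24 * x ^ 4)) (at x)"
    and "(F_special H4 \<longlongrightarrow> 0) at_bot" and "(F_special H4 \<longlongrightarrow> 1) at_top"
proof -
  have a: "- H4 / 24 > 0" using assms by simp
  have G: "Gamma (1 / 4 :: real) > 0" by (rule Gamma_real_pos) simp
  have "(\<integral>\<^sup>+x. ennreal (2 / Gamma (1/4) * (- H4 / 24) powr (1/4) * exp (H4 / 24 * x ^ 4)) \<partial>lborel) = 1"
    using nn_integral_quartic[OF a] by simp
  moreover have "continuous_on UNIV (\<lambda>x. 2 / Gamma (1/4) * (- H4 / 24) powr (1/4) * exp (H4 / 24 * x ^ 4))"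
    by (intro continuous_intros)
  moreover have "0 \<le> 2 / Gamma (1/4) * (- H4 / 24) powr (1/4) * exp (H4 / 24 * x ^ 4)" for x
    using G by simp
  ultimately show "(F_special H4 has_real_derivative
      2 / Gamma (1/4) * (- H4 / 24) powr (1/4) * exp (H4 / 24 * x ^ 4)) (at x)"
    "(F_special H4 \<longlongrightarrow> 0) at_bot" "(F_special H4 \<longlongrightarrow> 1) at_top"
    unfolding F_special_def[abs_def] by (intro density_cdf; blast)+
qed

lemma gaussian_limit:
  assumes m: "-1 < m" "m < 1" "global_max \<beta> h p m" and neg: "Hder 2 \<beta> h p m < 0"
    and nbhd: "r > 0" "\<And>x. \<bar>x - m\<bar> < r \<Longrightarrow> x \<in> A"
    and other: "\<And>m'. global_max \<beta> h p m' \<Longrightarrow> m' \<noteq> m \<Longrightarrow> m' \<notin> closure A"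
  shows "\<exists>C. \<forall>\<^sub>F N in sequentially. \<forall>x.
    \<bar>cw_cond_prob N \<beta> h p (\<lambda>X. (S_N N X - real N * m) / sqrt (- real N / Hder 2 \<beta> h p m) \<le> x)
        (\<lambda>X. S_N N X / real N \<in> A) - Phi x\<bar> \<le> C / sqrt (real N)"
proof -
  \<comment> \<open>In the variable \<open>sqrt N * (x - m)\<close> the limit has variance
    \<open>1 / \<sigma>^2\<close>, hence distribution function \<open>Phi (\<sigma> * s)\<close>.
    Rescaling the threshold by \<open>\<sigma>\<close> recovers \<open>Phi\<close>, and a bound
    uniform in the threshold survives this.\<close>
  define \<sigma> where "\<sigma> = sqrt (- Hder 2 \<beta> h p m)"
  have \<sigma>: "\<sigma> > 0" "\<sigma>\<^sup>2 = - Hder 2 \<beta> h p m" using neg by (simp_all add: \<sigma>_def)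
  obtain M where M: "\<And>x. \<bar>x - m\<bar> \<le> (1 - \<bar>m\<bar>) / 2 \<Longrightarrow>
    \<bar>Hfun \<beta> h p x - Hfun \<beta> h p m + (- Hder 2 \<beta> h p m / 2) * (x - m) ^ 2\<bar> \<le> M * \<bar>x - m\<bar> ^ Suc 2"
    using quadratic_maximum[OF m] by blast
  define c where "c = \<sigma> / sqrt (2 * pi)"
  have F: "((\<lambda>s. Phi (\<sigma> * s)) has_real_derivative c * exp (- (- Hder 2 \<beta> h p m / 2) * s ^ 2)) (at s)" for s
  proof -
    have "((\<lambda>s. Phi (\<sigma> * s)) has_real_derivative std_normal_density (\<sigma> * s) * \<sigma>) (at s)"
      by (rule DERIV_chain2[OF Phi_cdf(1)]) (auto intro!: derivative_eq_intros)
    then show ?thesis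
      by (rule DERIV_cong) (simp add: normal_density_def c_def power_mult_distrib \<sigma>(2))
  qed
  have "filterlim (\<lambda>s. \<sigma> * s) at_bot at_bot" "filterlim (\<lambda>s. \<sigma> * s) at_top at_top"
    using \<sigma>(1) by real_asymp+
  then have lim: "((\<lambda>s. Phi (\<sigma> * s)) \<longlongrightarrow> 0) at_bot" "((\<lambda>s. Phi (\<sigma> * s)) \<longlongrightarrow> 1) at_top"
    by (auto intro: filterlim_compose[OF Phi_cdf(2)] filterlim_compose[OF Phi_cdf(3)])
  obtain C where C: "\<forall>\<^sub>F N in sequentially. \<forall>y.
    \<bar>cw_cond_prob N \<beta> h p (\<lambda>X. real N powr (1 / real 2) * (S_N N X / real N - m) \<le> y)
        (\<lambda>X. S_N N X / real N \<in> A) - Phi (\<sigma> * y)\<bar> \<le> C / real N powr (1 / real 2)"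
    using cw_local_limit[OF m(1,2) _ _ _ _ M nbhd maximum_gap[OF m(3) other] F lim] \<sigma> neg
    by (auto simp: c_def)
  have conv: "(S_N N X - real N * m) / sqrt (- real N / Hder 2 \<beta> h p m) \<le> x
      \<longleftrightarrow> real N powr (1 / real 2) * (S_N N X / real N - m) \<le> x / \<sigma>" if "N \<ge> 1" for N X x
  proof -
    define n where "n = sqrt (real N)"
    have n: "n > 0" "real N = n * n" using that by (simp_all add: n_def)
    have "- real N / Hder 2 \<beta> h p m = real N / \<sigma>\<^sup>2" by (simp add: \<sigma>(2))
    then have sq: "sqrt (- real N / Hder 2 \<beta> h p m) = n / \<sigma>"
      using \<sigma>(1) by (simp add: real_sqrt_divide n_def)
    have "(S_N N X - real N * m) / sqrt (- real N / Hder 2 \<beta> h p m) = n * (S_N N X / real N - m) * \<sigma>"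
      unfolding sq unfolding n(2) using n(1) \<sigma>(1) by (simp add: field_simps)
    moreover have "real N powr (1 / real 2) = n" using that by (simp add: powr_half_sqrt n_def)
    ultimately show ?thesis by (simp only: pos_le_divide_eq[OF \<sigma>(1)])
  qed
  show ?thesis
  proof (intro exI[of _ C])
    show "\<forall>\<^sub>F N in sequentially. \<forall>x.
      \<bar>cw_cond_prob N \<beta> h p (\<lambda>X. (S_N N X - real N * m) / sqrt (- real N / Hder 2 \<beta> h p m) \<le> x)
        (\<lambda>X. S_N N X / real N \<in> A) - Phi x\<bar> \<le> C / sqrt (real N)"
      using C eventually_ge_at_top[of 1]
    proof eventually_elim
      case (elim N)
      show ?case
      proof
        fix x
        show "\<bar>cw_cond_prob N \<beta> h p (\<lambda>X. (S_N N X - real N * m) / sqrt (- real N / Hder 2 \<beta> h p m) \<le> x)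
          (\<lambda>X. S_N N X / real N \<in> A) - Phi x\<bar> \<le> C / sqrt (real N)"
          unfolding conv[OF elim(2)] using elim(1)[rule_format, of "x / \<sigma>"] \<sigma>(1)
          by (simp add: powr_half_sqrt)
      qed
    qed
  qed
qed

lemma special_limit:
  assumes p: "p \<ge> 3" and m: "-1 < m" "m < 1" "global_max \<beta> h p m" and zero: "Hder 2 \<beta> h p m = 0"
    and unique: "\<And>m'. global_max \<beta> h p m' \<Longrightarrow> m' = m"
  shows "\<exists>C. \<forall>\<^sub>F N in sequentially. \<forall>x.
    \<bar>cw_prob N \<beta> h p (\<lambda>X. (S_N N X - real N * m) / real N powr (3/4) \<le> x)
        - F_special (Hder 4 \<beta> h p m) x\<bar> \<le> C / real N powr (1/4)"
proof -
  note Hder = Hder_eq_Hd[OF m(1,2)]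
  have d1: "Hd \<beta> h p 1 m = 0"
    by (rule global_max_derivs(2)[OF m(1,2) _ m(3)]) auto
  have d2: "Hd \<beta> h p 2 m = 0" using zero by (simp add: Hder)
  have d3: "Hd \<beta> h p 3 m = 0" and neg: "Hder 4 \<beta> h p m < 0"
    using special_derivs[OF p m d2] by (simp_all add: Hder)
  have zero4: "Hd \<beta> h p k m = 0" if "1 \<le> k" "k < 4" for k
  proof -
    have "k = 1 \<or> k = 2 \<or> k = 3" using that by linarith
    then show ?thesis using d1 d2 d3 by auto
  qed
  obtain M where "\<And>x. \<bar>x - m\<bar> \<le> (1 - \<bar>m\<bar>) / 2 \<Longrightarrow>
    \<bar>Hfun \<beta> h p x - Hfun \<beta> h p m - Hd \<beta> h p 4 m / fact 4 * (x - m) ^ 4\<bar> \<le> M * \<bar>x - m\<bar> ^ Suc 4"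
    using Hfun_taylor[OF m(1,2) _ zero4] by (metis one_le_numeral)
  then have M: "\<bar>Hfun \<beta> h p x - Hfun \<beta> h p m + (- Hder 4 \<beta> h p m / 24) * (x - m) ^ 4\<bar>
      \<le> M * \<bar>x - m\<bar> ^ Suc 4" if "\<bar>x - m\<bar> \<le> (1 - \<bar>m\<bar>) / 2" for x
    using that by (simp add: Hder fact_numeral)
  define c where "c = 2 / Gamma (1/4) * (- Hder 4 \<beta> h p m / 24) powr (1/4)"
  have "Gamma (1 / 4 :: real) > 0" by (rule Gamma_real_pos) simp
  then have c: "c > 0" using neg by (simp add: c_def)
  have F: "(F_special (Hder 4 \<beta> h p m) has_real_derivative
      c * exp (- (- Hder 4 \<beta> h p m / 24) * s ^ 4)) (at s)" for s
    using F_special_cdf(1)[OF neg, of s] by (simp add: c_def)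
  have gap: "\<exists>\<eta>>0. \<forall>x\<in>UNIV \<inter> {-1..1}. \<delta> \<le> \<bar>x - m\<bar> \<longrightarrow> Hfun \<beta> h p x \<le> Hfun \<beta> h p m - \<eta>"
    if "\<delta> > 0" for \<delta>
    using unique that by (intro maximum_gap m(3)) auto
  obtain C where C: "\<forall>\<^sub>F N in sequentially. \<forall>y.
    \<bar>cw_cond_prob N \<beta> h p (\<lambda>X. real N powr (1 / real 4) * (S_N N X / real N - m) \<le> y)
        (\<lambda>X. S_N N X / real N \<in> UNIV) - F_special (Hder 4 \<beta> h p m) y\<bar> \<le> C / real N powr (1 / real 4)"
    using cw_local_limit[OF m(1,2) _ _ _ c M zero_less_one _ gap F F_special_cdf(2,3)[OF neg]] neg
    by auto
  show ?thesis
  proof (intro exI[of _ C])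
    show "\<forall>\<^sub>F N in sequentially. \<forall>x.
      \<bar>cw_prob N \<beta> h p (\<lambda>X. (S_N N X - real N * m) / real N powr (3/4) \<le> x)
        - F_special (Hder 4 \<beta> h p m) x\<bar> \<le> C / real N powr (1/4)"
      using C eventually_ge_at_top[of 1]
    proof eventually_elim
      case (elim N)
      \<comment> \<open>Dividing \<open>S_N - N * m\<close> by \<open>N^(3/4)\<close> is the same as
        multiplying \<open>S_N / N - m\<close> by \<open>T = N^(1/4)\<close>.\<close>
      have "real N powr (1 / 4) * real N powr (3 / 4) = real N"
        using elim(2) by (simp flip: powr_add)
      then have "(s - real N * m) / real N powr (3/4) = real N powr (1 / 4) * (s / real N - m)" for s
        using elim(2) by (simp add: divide_simps) (simp add: algebra_simps)
      then show ?case
        using elim(1) by (simp add: cw_prob_eq_cond[OF elim(2)])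
    qed
  qed
qed

theorem theorem3p2:
  fixes p :: nat and \<beta> h :: real
  assumes "p \<ge> 3" and "\<beta> > 0" and "h > 0"
  shows
   "(p_regular \<beta> h p \<longrightarrow> (\<forall>m. global_max \<beta> h p m \<longrightarrow>
      (\<exists>C. \<forall>\<^sub>F N in sequentially. \<forall>x::real.
         \<bar>cw_prob N \<beta> h p (\<lambda>X. (S_N N X - real N * m) / sqrt (- real N / Hder 2 \<beta> h p m) \<le> x)
           - Phi x\<bar> \<le> C / sqrt (real N))))
  \<and> (p_critical \<beta> h p \<longrightarrow> (\<forall>m A. global_max \<beta> h p m \<and> is_nbhd A m
        \<and> (\<forall>m'. global_max \<beta> h p m' \<and> m' \<noteq> m \<longrightarrow> m' \<notin> closure A) \<longrightarrow>
      (\<exists>C. \<forall>\<^sub>F N in sequentially. \<forall>x::real.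
         \<bar>cw_cond_prob N \<beta> h p
             (\<lambda>X. (S_N N X - real N * m) / sqrt (- real N / Hder 2 \<beta> h p m) \<le> x)
             (\<lambda>X. S_N N X / real N \<in> A)
           - Phi x\<bar> \<le> C / sqrt (real N))))
  \<and> (p_special \<beta> h p \<longrightarrow> (\<forall>m. global_max \<beta> h p m \<longrightarrow>
      (\<exists>C. \<forall>\<^sub>F N in sequentially. \<forall>x::real. x > 0 \<longrightarrow>
         \<bar>cw_prob N \<beta> h p (\<lambda>X. (S_N N X - real N * m) / real N powr (3/4) \<le> x)
           - F_special (Hder 4 \<beta> h p m) x\<bar> \<le> C / real N powr (1/4))))"
proof (intro conjI impI allI)
  fix m assume reg: "p_regular \<beta> h p" and m: "global_max \<beta> h p m"
  have m_props: "-1 < m" "m < 1" "Hder 2 \<beta> h p m < 0" "\<And>m'. global_max \<beta> h p m' \<Longrightarrow> m' = m"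
  proof -
    obtain m0 where "{x. global_max \<beta> h p x} = {m0}" "-1 < m0" "m0 < 1" "Hder 2 \<beta> h p m0 < 0"
      using reg unfolding p_regular_def by blast
    moreover from this have "m = m0" using m by blast
    ultimately show "-1 < m" "m < 1" "Hder 2 \<beta> h p m < 0" "\<And>m'. global_max \<beta> h p m' \<Longrightarrow> m' = m"
      by blast+
  qed
  \<comment> \<open>On the whole line every radius satisfies the neighborhood hypothesis, so 1 is
    taken; uniqueness of the maximizer settles the closure condition.\<close>
  have "\<exists>C. \<forall>\<^sub>F N in sequentially. \<forall>x.
      \<bar>cw_cond_prob N \<beta> h p (\<lambda>X. (S_N N X - real N * m) / sqrt (- real N / Hder 2 \<beta> h p m) \<le> x)
        (\<lambda>X. S_N N X / real N \<in> UNIV) - Phi x\<bar> \<le> C / sqrt (real N)"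
    by (rule gaussian_limit[OF m_props(1,2) m m_props(3) zero_less_one UNIV_I]) (blast dest: m_props(4))
  then obtain C where C: "\<forall>\<^sub>F N in sequentially. \<forall>x.
      \<bar>cw_cond_prob N \<beta> h p (\<lambda>X. (S_N N X - real N * m) / sqrt (- real N / Hder 2 \<beta> h p m) \<le> x)
        (\<lambda>X. S_N N X / real N \<in> UNIV) - Phi x\<bar> \<le> C / sqrt (real N)"
    by blast
  have "\<forall>\<^sub>F N in sequentially. \<forall>x.
      \<bar>cw_prob N \<beta> h p (\<lambda>X. (S_N N X - real N * m) / sqrt (- real N / Hder 2 \<beta> h p m) \<le> x)
        - Phi x\<bar> \<le> C / sqrt (real N)"
    using C eventually_ge_at_top[of 1] by eventually_elim (simp only: cw_prob_eq_cond simp_thms)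
  then show "\<exists>C. \<forall>\<^sub>F N in sequentially. \<forall>x.
      \<bar>cw_prob N \<beta> h p (\<lambda>X. (S_N N X - real N * m) / sqrt (- real N / Hder 2 \<beta> h p m) \<le> x)
        - Phi x\<bar> \<le> C / sqrt (real N)" by blast
next
  fix m A
  assume crit: "p_critical \<beta> h p" and mA: "global_max \<beta> h p m \<and> is_nbhd A m
    \<and> (\<forall>m'. global_max \<beta> h p m' \<and> m' \<noteq> m \<longrightarrow> m' \<notin> closure A)"
  then have m: "global_max \<beta> h p m" by blast
  obtain m' where m': "global_max \<beta> h p m'" "m' \<noteq> m"
    using crit unfolding p_critical_def by metis
  note int = global_max_interior[OF assms m]
  \<comment> \<open>Criticality only provides a second maximizer; its presence is what excludes
    degeneracy of \<open>m\<close>.\<close>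
  have "Hder 2 \<beta> h p m < 0"
    using critical_Hd_2_neg[OF assms m m'] Hder_eq_Hd[of m 2 \<beta> h p] int by simp
  moreover obtain U where U: "open U" "m \<in> U" "U \<subseteq> A" using mA unfolding is_nbhd_def by blast
  then obtain r where r: "r > 0" "ball m r \<subseteq> U" using open_contains_ball by blast
  have "x \<in> A" if "\<bar>x - m\<bar> < r" for x
    using that r(2) U(3) by (auto simp: ball_def dist_real_def abs_minus_commute)
  ultimately show "\<exists>C. \<forall>\<^sub>F N in sequentially. \<forall>x.
      \<bar>cw_cond_prob N \<beta> h p (\<lambda>X. (S_N N X - real N * m) / sqrt (- real N / Hder 2 \<beta> h p m) \<le> x)
        (\<lambda>X. S_N N X / real N \<in> A) - Phi x\<bar> \<le> C / sqrt (real N)"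
    using int m r(1) mA by (intro gaussian_limit[of m \<beta> h p r A]) auto
next
  fix m assume spec: "p_special \<beta> h p" and m: "global_max \<beta> h p m"
  have m_props: "-1 < m" "m < 1" "Hder 2 \<beta> h p m = 0" "\<And>m'. global_max \<beta> h p m' \<Longrightarrow> m' = m"
  proof -
    obtain m0 where "{x. global_max \<beta> h p x} = {m0}" "-1 < m0" "m0 < 1" "Hder 2 \<beta> h p m0 = 0"
      using spec unfolding p_special_def by blast
    moreover from this have "m = m0" using m by blast
    ultimately show "-1 < m" "m < 1" "Hder 2 \<beta> h p m = 0" "\<And>m'. global_max \<beta> h p m' \<Longrightarrow> m' = m"
      by blast+
  qed
  have "\<exists>C. \<forall>\<^sub>F N in sequentially. \<forall>x.
      \<bar>cw_prob N \<beta> h p (\<lambda>X. (S_N N X - real N * m) / real N powr (3/4) \<le> x)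
        - F_special (Hder 4 \<beta> h p m) x\<bar> \<le> C / real N powr (1/4)"
    by (rule special_limit[OF \<open>p \<ge> 3\<close> m_props(1,2) m m_props(3,4)])
  then obtain C where "\<forall>\<^sub>F N in sequentially. \<forall>x.
      \<bar>cw_prob N \<beta> h p (\<lambda>X. (S_N N X - real N * m) / real N powr (3/4) \<le> x)
        - F_special (Hder 4 \<beta> h p m) x\<bar> \<le> C / real N powr (1/4)"
    by blast
  then show "\<exists>C. \<forall>\<^sub>F N in sequentially. \<forall>x>0.
      \<bar>cw_prob N \<beta> h p (\<lambda>X. (S_N N X - real N * m) / real N powr (3/4) \<le> x)
        - F_special (Hder 4 \<beta> h p m) x\<bar> \<le> C / real N powr (1/4)"
    by (intro exI[of _ C]) (auto elim!: eventually_mono)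
qed

end
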